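(* Let $(z_n)_{n\in\mathbb{N}}$ be a sequence of distinct complex numbers in the unit disc $\mathbb{D}$, and let $\psi\in\mathcal{R}$ satisfy $\psi(2x)=O(\psi(x))$ as $x\to+\infty$. The following conditions are equivalent: (i) for every sequence $(b_n)$ of complex numbers such that there is $C>0$ with $\ln|b_n|\le C\,\psi\bigl(\frac{1}{1-|z_n|}\bigr)$ for all $n\in\mathbb{N}$, there exist an analytic function $f$ in $\mathbb{D}$ and a constant $C'>0$ such that $f(z_n)=b_n$ for all $n\in\mathbb{N}$ and $\ln M(r,f)\le C'\,\psi\bigl(\frac{1}{1-r}\bigr)$ for all $r\in(0,1)$; (ii) there exists $C>0$ such that for all $n\in\mathbb{N}$ $$N_{z_n}\Bigl(\frac{1-|z_n|}{2}\Bigr)\le C\,\psi\Bigl(\frac{1}{1-|z_n|}\Bigr);$$ (iii) there exists $C>0$ such that for all $n\in\mathbb{N}$ $$\sum_{0<|z_n-z_j|<\frac12(1-|z_n|)}\ln\frac{1}{\sigma(z_n,z_j)}\le C\,\psi\Bigl(\frac{1}{1-|z_n|}\Bigr).$$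
   Context: $\mathbb{D}=\{z\in\mathbb{C}:|z|<1\}$. For $f$ analytic in $\mathbb{D}$ and $r\in(0,1)$, $M(r,f)=\max\{|f(z)|:|z|=r\}$. $\sigma(z,\zeta)=\bigl|\frac{z-\zeta}{1-\bar z\zeta}\bigr|$ is the pseudohyperbolic distance in $\mathbb{D}$. For a sequence $(z_k)$ in $\mathbb{D}$, $\zeta\in\mathbb{D}$ and $t\ge0$, $n_\zeta(t)$ is the number of members $z_k$ of the sequence with $|z_k-\zeta|\le t$, and $N_\zeta(r)=\int_0^r\frac{(n_\zeta(t)-1)^+}{t}\,dt$, where $x^+=\max\{x,0\}$. For a nondecreasing $\psi\colon[1,+\infty)\to(0,+\infty)$, $\tilde\psi(x)=\int_1^x\frac{\psi(t)}{t}\,dt$. The class $\mathcal{R}$ consists of the nondecreasing functions $\psi\colon[1,+\infty)\to(0,+\infty)$ such that $\tilde\psi(r)=O(\psi(r))$ as $r\to+\infty$. Convention: $\ln 0=-\infty$. *)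

theory Defs
  imports
    "HOL-Complex_Analysis.Complex_Analysis"
    "HOL-Library.Landau_Symbols"
begin

(* The library has ln 0 = 0; this version takes the value -\<infinity> at 0. *)
definition eln :: "real \<Rightarrow> ereal" where
  "eln x = (if x = 0 then -\<infinity> else ereal (ln x))"

(* For f analytic in the unit disc and 0 < r < 1 the supremum is attained. *)
definition max_modulus :: "real \<Rightarrow> (complex \<Rightarrow> complex) \<Rightarrow> real" where
  "max_modulus r f = (SUP z\<in>{z. norm z = r}. norm (f z))"

definition pseudohyperbolic_dist :: "complex \<Rightarrow> complex \<Rightarrow> real" where
  "pseudohyperbolic_dist z w = norm ((z - w) / (1 - cnj z * w))"

(* Members of the sequence are counted by index. A sequence that accumulates in the disc
   gives the value \<infinity>, which card would turn into 0. *)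
definition count_near :: "(nat \<Rightarrow> complex) \<Rightarrow> complex \<Rightarrow> real \<Rightarrow> ennreal" where
  "count_near z w t = emeasure (count_space UNIV) {k. norm (z k - w) \<le> t}"

(* Subtraction on ennreal is truncated at 0, so it is the positive part of the difference. *)
definition integrated_count :: "(nat \<Rightarrow> complex) \<Rightarrow> complex \<Rightarrow> real \<Rightarrow> ennreal" where
  "integrated_count z w r =
     (\<integral>\<^sup>+t\<in>{0..r}. ((count_near z w t - 1) / ennreal t) \<partial>lborel)"

definition log_integral :: "(real \<Rightarrow> real) \<Rightarrow> real \<Rightarrow> real" where
  "log_integral \<psi> x = integral {1..x} (\<lambda>t. \<psi> t / t)"

(* Functions on [1, \<infinity>) are represented by total functions whose values below 1 are irrelevant. *)
definition class_R :: "(real \<Rightarrow> real) set" where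
  "class_R = {\<psi>. mono_on {1..} \<psi> \<and> (\<forall>x\<ge>1. \<psi> x > 0) \<and> log_integral \<psi> \<in> O[at_top](\<psi>)}"

definition interpolation_property :: "(nat \<Rightarrow> complex) \<Rightarrow> (real \<Rightarrow> real) \<Rightarrow> bool" where
  "interpolation_property z \<psi> \<longleftrightarrow>
     (\<forall>b :: nat \<Rightarrow> complex.
        (\<exists>C>0. \<forall>n. eln (norm (b n)) \<le> ereal (C * \<psi> (1 / (1 - norm (z n))))) \<longrightarrow>
        (\<exists>f C'. f analytic_on ball 0 1 \<and> C' > 0 \<and> (\<forall>n. f (z n) = b n) \<and>
           (\<forall>r\<in>{0<..<1}. eln (max_modulus r f) \<le> ereal (C' * \<psi> (1 / (1 - r))))))"

definition integrated_count_bounded :: "(nat \<Rightarrow> complex) \<Rightarrow> (real \<Rightarrow> real) \<Rightarrow> bool" where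
  "integrated_count_bounded z \<psi> \<longleftrightarrow>
     (\<exists>C>0. \<forall>n. integrated_count z (z n) ((1 - norm (z n)) / 2)
        \<le> ennreal (C * \<psi> (1 / (1 - norm (z n)))))"

(* For distinct points of the disc the summands are positive, so applying ennreal loses nothing;
   an infinite sum has the value \<infinity> when it diverges. *)
definition log_separation_bounded :: "(nat \<Rightarrow> complex) \<Rightarrow> (real \<Rightarrow> real) \<Rightarrow> bool" where
  "log_separation_bounded z \<psi> \<longleftrightarrow>
     (\<exists>C>0. \<forall>n.
        (\<Sum>\<^sub>\<infinity>j\<in>{j. 0 < norm (z n - z j) \<and> norm (z n - z j) < 1/2 * (1 - norm (z n))}.
           ennreal (ln (1 / pseudohyperbolic_dist (z n) (z j))))
        \<le> ennreal (C * \<psi> (1 / (1 - norm (z n)))))"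

end

theory Submission
  imports Defs
begin

text \<open>
  Write \<open>\<psi>\<^sub>\<zeta> = \<psi> (1 / (1 - |\<zeta>|))\<close> and \<open>r\<^sub>n = (1 - |z\<^sub>n|) / 2\<close>. Both counting conditions are first turned into
  bounds for finite sums: the integral of \<open>(n(t) - 1) / t\<close> is the sum of \<open>ln (r\<^sub>n / |z\<^sub>n - z\<^sub>j|)\<close>
  (\<open>integrated_count_eq\<close>). Since \<open>|1 - cnj z\<^sub>n * z\<^sub>j|\<close> is comparable to \<open>r\<^sub>n\<close> when
  \<open>|z\<^sub>n - z\<^sub>j| < r\<^sub>n\<close>, the summands of (ii) and (iii) differ by at most \<open>ln 5\<close>, so the two conditions
  agree once the number of points within \<open>r\<^sub>n\<close> of \<open>z\<^sub>n\<close> is \<open>O(\<psi>)\<close>. That number is controlled by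
  applying the condition at the nearby points themselves (\<open>card_near_le_if_count_sums\<close>).

  Necessity is Jensen's inequality. If (ii) failed, there would be points \<open>z\<^sub>n\<close> approaching the circle
  along which the sum exceeds any multiple of \<open>\<psi>\<close>. Choose them so sparse that none lies in
  the disc belonging to another, and interpolate the value 1 at these points and 0 at all others: a
  function that is 1 at the centre and vanishes at every other point of the disc must be
  exponentially large on its boundary (\<open>norm_centre_mult_prod_zeros_le\<close>), which contradicts its growth.

  For sufficiency let \<open>A\<^sub>w(\<zeta>) = (1 - |w|\<^sup>2) / (1 - cnj w * \<zeta>)\<close>. The Blaschke factor \<open>B\<^sub>w\<close> of \<open>w\<close> satisfies
  \<open>1 - A\<^sub>w = cnj w * B\<^sub>w\<close>, so \<open>e\<^sub>w = B\<^sub>w * exp (A\<^sub>w + A\<^sub>w\<^sup>2/2 + ... + A\<^sub>w\<^sup>s/s)\<close> is a Weierstrass elementary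
  factor in \<open>A\<^sub>w\<close> up to a constant: as \<open>A\<^sub>w\<close> tends to 0, it differs from
  that constant by \<open>O(|A\<^sub>w|\<^sup>s\<^sup>+\<^sup>1)\<close>.
  The sequence need not satisfy the Blaschke condition, but the sum of these powers over the
  sequence is \<open>O(\<psi>\<^sub>\<zeta>)\<close> for large \<open>s\<close> (\<open>kernel_power_sum_le\<close>); this is where the bound for
  the integral of \<open>\<psi>(t) / t\<close> enters. With \<open>P\<^sub>n\<close> the product of \<open>e\<^sub>j(\<zeta>) / e\<^sub>j(z\<^sub>n)\<close> over \<open>j \<noteq> n\<close>, condition (iii) bounds the
  denominators coming from points near \<open>z\<^sub>n\<close>, so \<open>ln |P\<^sub>n(\<zeta>)| = O(\<psi>\<^sub>\<zeta> + \<psi>\<^sub>n)\<close> where \<open>\<psi>\<^sub>n\<close> belongs to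
  \<open>z\<^sub>n\<close>. The interpolating function is the sum over \<open>n\<close> of
  \<open>b\<^sub>n * P\<^sub>n * A\<^sub>n\<^sup>s\<^sup>+\<^sup>1 * exp (k * \<psi>\<^sub>n * (A\<^sub>n\<^sup>q - 1))\<close>: the last factor
  is 1 at \<open>z\<^sub>n\<close> and trades the growth in \<open>\<psi>\<^sub>n\<close> for growth in \<open>\<psi>\<^sub>\<zeta>\<close>, the power of \<open>A\<^sub>n\<close> makes the sum converge.
  Finite sections obey a bound that does not depend on their size (\<open>finite_interpolation\<close>), and Montel's
  theorem supplies the limit, so no infinite product or series has to be treated.
\<close>

section \<open>Distances and kernels in the unit disc\<close>

text \<open>
  This kernel is 1 at \<open>w\<close>, at most 2 in modulus on the disc, and small at points whose distance to
  \<open>w\<close> is large compared with \<open>1 - |w|\<close>.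
\<close>

definition disc_kernel :: "complex \<Rightarrow> complex \<Rightarrow> complex" where
  "disc_kernel w z = of_real (1 - (norm w)\<^sup>2) / (1 - cnj w * z)"

text \<open>
  A Blaschke factor times the exponential of a partial sum of \<open>- ln (1 - u)\<close>, taken at the kernel
  \<open>u\<close>. The usual normalisation would make this the elementary factor \<open>E(u)\<close>, which
  degenerates to the constant 0 when \<open>w = 0\<close>; only quotients of two values of the
  factor occur below, and they are insensitive to the normalisation.
\<close>

definition tempered_factor :: "nat \<Rightarrow> complex \<Rightarrow> complex \<Rightarrow> complex" where
  "tempered_factor s w z =
     (w - z) / (1 - cnj w * z) * exp (\<Sum>k=1..s. disc_kernel w z ^ k / of_nat k)"

lemma cnj_mult_self: "cnj w * w = of_real ((norm w)\<^sup>2)"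
  using complex_norm_square by (simp only: mult.commute)

lemma norm_one_minus_cnj_mult_sq:
  "(norm (1 - cnj w * z))\<^sup>2 = (norm (w - z))\<^sup>2 + (1 - (norm w)\<^sup>2) * (1 - (norm z)\<^sup>2)"
proof -
  have re: "Re (1 - cnj w * z) = 1 - (Re w * Re z + Im w * Im z)"
    and im: "Im (1 - cnj w * z) = Im w * Re z - Re w * Im z"
    by simp_all
  have "(norm (1 - cnj w * z))\<^sup>2
      = (1 - (Re w * Re z + Im w * Im z))\<^sup>2 + (Im w * Re z - Re w * Im z)\<^sup>2"
    unfolding cmod_power2 re im ..
  then show ?thesis
    unfolding cmod_power2 minus_complex.sel by (simp add: power2_eq_square algebra_simps)
qed

lemma
  assumes "norm w < 1" "norm z < 1"
  shows norm_diff_le_denominator: "norm (w - z) \<le> norm (1 - cnj w * z)"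
    and boundary_dist_le_denominator: "1 - norm w \<le> norm (1 - cnj w * z)"
    and boundary_dist_le_denominator': "1 - norm z \<le> norm (1 - cnj w * z)"
    and denominator_pos: "0 < norm (1 - cnj w * z)"
    and denominator_nonzero: "1 - cnj w * z \<noteq> 0"
proof -
  have "(1 - (norm w)\<^sup>2) * (1 - (norm z)\<^sup>2) \<ge> 0"
    using assms by (intro mult_nonneg_nonneg) (auto simp: power_le_one)
  then have "(norm (w - z))\<^sup>2 \<le> (norm (1 - cnj w * z))\<^sup>2"
    unfolding norm_one_minus_cnj_mult_sq by linarith
  then show "norm (w - z) \<le> norm (1 - cnj w * z)"
    by (rule power2_le_imp_le) (rule norm_ge_zero)
  have "1 - norm w * norm z \<le> norm (1 - cnj w * z)"
    using norm_triangle_ineq2[of 1 "cnj w * z"] by (simp add: norm_mult)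
  moreover have "norm w * norm z \<le> norm w" "norm w * norm z \<le> norm z"
    using assms by (auto intro: mult_left_le mult_left_le_one_le)
  ultimately show "1 - norm w \<le> norm (1 - cnj w * z)" "1 - norm z \<le> norm (1 - cnj w * z)"
    by linarith+
  then show "0 < norm (1 - cnj w * z)" using assms by linarith
  then show "1 - cnj w * z \<noteq> 0" unfolding zero_less_norm_iff .
qed

lemma norm_disc_kernel:
  assumes "norm w < 1"
  shows "norm (disc_kernel w z) = (1 - norm w) * (1 + norm w) / norm (1 - cnj w * z)"
proof -
  have "(1 - (norm w)\<^sup>2) = (1 - norm w) * (1 + norm w)"
    by (simp add: algebra_simps power2_eq_square)
  then show ?thesis using assms
    unfolding disc_kernel_def norm_divide norm_of_real by simp
qed

lemma norm_disc_kernel_le: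
  assumes "norm w < 1" "norm z < 1" "0 < d" "d \<le> norm (1 - cnj w * z)"
  shows "norm (disc_kernel w z) \<le> 2 * (1 - norm w) / d"
proof -
  have "(1 - norm w) * (1 + norm w) \<le> (1 - norm w) * 2"
    using assms by (intro mult_left_mono) auto
  then show ?thesis using assms unfolding norm_disc_kernel[OF assms(1)]
    by (intro frac_le) auto
qed

lemma
  assumes "norm w < 1" "norm z < 1"
  shows norm_disc_kernel_le_2: "norm (disc_kernel w z) \<le> 2"
    and norm_disc_kernel_le_quotient:
      "norm (disc_kernel w z) \<le> 2 * ((1 - norm w) / (1 - norm z))"
    and norm_disc_kernel_ge: "1 - norm w \<le> norm (disc_kernel w z)"
proof -
  have "norm (disc_kernel w z) \<le> 2 * (1 - norm w) / (1 - norm w)"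
    using norm_disc_kernel_le[OF assms _ boundary_dist_le_denominator] assms by auto
  also have "\<dots> = 2" using assms(1) by (simp add: divide_simps)
  finally show "norm (disc_kernel w z) \<le> 2" .
  show "norm (disc_kernel w z) \<le> 2 * ((1 - norm w) / (1 - norm z))"
    using norm_disc_kernel_le[OF assms _ boundary_dist_le_denominator'] assms by auto
  have "norm (1 - cnj w * z) \<le> 1 + norm w * norm z"
    using norm_triangle_ineq4[of 1 "cnj w * z"] by (simp add: norm_mult)
  also have "\<dots> \<le> 1 + norm w" using assms by (auto intro: mult_left_le)
  finally have "(1 - norm w) * norm (1 - cnj w * z) \<le> (1 - norm w) * (1 + norm w)"
    using assms by (intro mult_left_mono) auto
  then show "1 - norm w \<le> norm (disc_kernel w z)"
    unfolding norm_disc_kernel[OF assms(1)] pos_le_divide_eq[OF denominator_pos[OF assms]] .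
qed

lemma disc_kernel_self: "norm w < 1 \<Longrightarrow> disc_kernel w w = 1"
proof -
  assume w: "norm w < 1"
  have eq: "cnj w * w = of_real ((norm w)\<^sup>2)"
    by (rule cnj_mult_self)
  have "(norm w)\<^sup>2 < 1" using w by (simp add: abs_square_less_1)
  then have "(of_real (1 - (norm w)\<^sup>2) :: complex) \<noteq> 0"
    unfolding of_real_eq_0_iff by linarith
  then show ?thesis unfolding disc_kernel_def eq of_real_diff of_real_1 by (rule divide_self)
qed

text \<open>
  This identity links the Blaschke factor with the Weierstrass factor: being close to a unimodular
  constant means that the kernel is small.
\<close>

lemma one_minus_disc_kernel:
  assumes "norm w < 1" "norm z < 1"
  shows "1 - disc_kernel w z = cnj w * ((w - z) / (1 - cnj w * z))"
proof -
  have eq: "cnj w * w = of_real ((norm w)\<^sup>2)"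
    by (rule cnj_mult_self)
  have "1 - cnj w * z \<noteq> 0" by (rule denominator_nonzero[OF assms])
  then have "1 - disc_kernel w z = ((1 - cnj w * z) - of_real (1 - (norm w)\<^sup>2)) / (1 - cnj w * z)"
    unfolding disc_kernel_def diff_divide_distrib[of "1 - cnj w * z" "of_real (1 - (norm w)\<^sup>2)"]
    by simp
  also have "(1 - cnj w * z) - of_real (1 - (norm w)\<^sup>2) = cnj w * (w - z)"
    unfolding of_real_diff of_real_1 eq[symmetric] by (simp add: right_diff_distrib)
  finally show ?thesis by (simp only: times_divide_eq_right)
qed

lemma weierstrass_factor_disc_kernel:
  assumes "norm w < 1" "norm z < 1"
  shows "weierstrass_factor s (disc_kernel w z) = cnj w * tempered_factor s w z"
  unfolding weierstrass_factor_def tempered_factor_def one_minus_disc_kernel[OF assms]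
  by (simp only: mult.assoc)

lemma pseudohyperbolic_dist_commute:
  "pseudohyperbolic_dist w z = pseudohyperbolic_dist z w"
proof -
  have "norm (1 - cnj w * z) = norm (1 - cnj z * w)"
    using complex_mod_cnj[of "1 - cnj w * z"] by (simp add: mult.commute)
  then show ?thesis by (simp add: pseudohyperbolic_dist_def norm_divide norm_minus_commute)
qed

lemma
  assumes "norm w < 1" "norm z < 1"
  shows pseudohyperbolic_dist_le_1: "pseudohyperbolic_dist w z \<le> 1"
    and pseudohyperbolic_dist_pos: "w \<noteq> z \<Longrightarrow> 0 < pseudohyperbolic_dist w z"
proof -
  have pos: "0 < norm (1 - cnj w * z)" and le: "norm (w - z) \<le> norm (1 - cnj w * z)"
    by (rule denominator_pos[OF assms], rule norm_diff_le_denominator[OF assms])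
  have eq: "pseudohyperbolic_dist w z = norm (w - z) / norm (1 - cnj w * z)"
    by (simp only: pseudohyperbolic_dist_def norm_divide)
  show "pseudohyperbolic_dist w z \<le> 1"
    using pos le unfolding eq by (simp only: divide_le_eq_1_pos)
  show "0 < pseudohyperbolic_dist w z" if "w \<noteq> z"
    using that unfolding eq by (intro divide_pos_pos pos) simp
qed

text \<open>
  For \<open>|w - z| < (1 - |w|) / 2\<close> this and \<open>boundary_dist_le_denominator\<close> show that the denominator
  of the pseudohyperbolic distance is comparable to \<open>1 - |w|\<close>.
\<close>

lemma denominator_le:
  assumes "norm w < 1"
  shows "norm (1 - cnj w * z) \<le> 2 * (1 - norm w) + norm (w - z)"
proof -
  have "(1 - cnj w * z) = of_real (1 - (norm w)\<^sup>2) + cnj w * (w - z)"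
    unfolding of_real_diff of_real_1 cnj_mult_self[symmetric] by (simp add: right_diff_distrib)
  then have "norm (1 - cnj w * z)
      \<le> norm (of_real (1 - (norm w)\<^sup>2) :: complex) + norm (cnj w * (w - z))"
    by (simp only: norm_triangle_ineq)
  moreover have "norm (of_real (1 - (norm w)\<^sup>2) :: complex) = (1 - norm w) * (1 + norm w)"
  proof -
    have "(norm w)\<^sup>2 \<le> 1" using assms by (simp add: power_le_one)
    then show ?thesis unfolding norm_of_real by (simp add: algebra_simps power2_eq_square)
  qed
  moreover have "(1 - norm w) * (1 + norm w) \<le> (1 - norm w) * 2"
    using assms by (intro mult_left_mono) auto
  moreover have "norm (cnj w * (w - z)) \<le> norm (w - z)"
    using assms mult_left_le_one_le[of "norm (w - z)" "norm w"] by (simp add: norm_mult)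
  ultimately show ?thesis by linarith
qed

section \<open>Blaschke factors with Weierstrass convergence factors\<close>

text \<open>
  Logarithmic form of the estimate of \<open>E(u) - 1\<close>. The lower bound needs \<open>|E(u) - 1|\<close> to stay
  below 1, which \<open>2 \<le> s\<close> ensures for \<open>|u| \<le> 1/2\<close>.
\<close>

lemma
  assumes "norm u \<le> 1 / 2" "2 \<le> s"
  shows norm_weierstrass_factor_le_exp: "norm (weierstrass_factor s u) \<le> exp (3 * norm u ^ Suc s)"
    and exp_le_norm_weierstrass_factor: "exp (- (6 * norm u ^ Suc s)) \<le> norm (weierstrass_factor s u)"
proof -
  define a where "a = norm u ^ Suc s"
  have a0: "0 \<le> a" by (simp add: a_def)
  have "a \<le> (1 / 2) ^ Suc s" unfolding a_def using assms by (intro power_mono) auto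
  also have "\<dots> \<le> (1 / 2 :: real) ^ 3" using assms by (intro power_decreasing) auto
  finally have a: "a \<le> 1 / 8" by (simp add: power3_eq_cube)
  have "norm (weierstrass_factor s u) \<le> 1 + 3 * a"
    using weierstrass_factor_bound[OF assms(1), of s]
      norm_triangle_ineq[of "weierstrass_factor s u - 1" 1] by (simp add: a_def)
  also have "\<dots> \<le> exp (3 * a)" by (rule exp_ge_add_one_self)
  finally show "norm (weierstrass_factor s u) \<le> exp (3 * norm u ^ Suc s)" by (simp add: a_def)
  have "exp (- (6 * a)) = 1 / exp (6 * a)" by (simp add: exp_minus inverse_eq_divide)
  also have "\<dots> \<le> 1 / (1 + 6 * a)" using a0 exp_ge_add_one_self[of "6 * a"] by (intro divide_left_mono) auto
  also have "\<dots> \<le> 1 - 3 * a"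
  proof -
    have "a * (6 * a) \<le> a * 1" using a a0 by (intro mult_left_mono) auto
    then have "1 \<le> (1 - 3 * a) * (1 + 6 * a)" using a0 by (simp add: algebra_simps)
    then show ?thesis using a0 by (simp add: divide_le_eq)
  qed
  also have "\<dots> \<le> norm (weierstrass_factor s u)"
    using weierstrass_factor_bound[OF assms(1), of s]
      norm_triangle_ineq2[of 1 "1 - weierstrass_factor s u"]
    by (simp add: a_def norm_minus_commute)
  finally show "exp (- (6 * norm u ^ Suc s)) \<le> norm (weierstrass_factor s u)" by (simp add: a_def)
qed

text \<open>
  A bound for the modulus of the exponent of \<open>tempered_factor\<close>, because the kernel is at most 2.
\<close>

definition exponent_bound :: "nat \<Rightarrow> real" where
  "exponent_bound s = (\<Sum>k=1..s. 2 ^ k)"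

lemma exponent_bound_nonneg: "0 \<le> exponent_bound s"
  by (simp add: exponent_bound_def sum_nonneg)

lemma
  assumes "norm w < 1" "norm z < 1"
  shows norm_tempered_factor_le: "norm (tempered_factor s w z) \<le> exp (exponent_bound s)"
    and norm_tempered_factor_ge:
      "pseudohyperbolic_dist w z * exp (- exponent_bound s) \<le> norm (tempered_factor s w z)"
proof -
  define E where "E = (\<Sum>k=1..s. disc_kernel w z ^ k / of_nat k)"
  have "norm E \<le> (\<Sum>k=1..s. norm (disc_kernel w z ^ k / of_nat k))"
    unfolding E_def by (rule norm_sum)
  also have "\<dots> \<le> exponent_bound s"
    unfolding exponent_bound_def
  proof (rule sum_mono)
    fix k assume "k \<in> {1..s}"
    then have "norm (disc_kernel w z) ^ k / real k \<le> 2 ^ k / 1"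
      using norm_disc_kernel_le_2[OF assms] by (intro frac_le power_mono) auto
    then show "norm (disc_kernel w z ^ k / of_nat k) \<le> 2 ^ k" by (simp add: norm_divide norm_power)
  qed
  finally have E: "norm E \<le> exponent_bound s" .
  have eq: "norm (tempered_factor s w z) = pseudohyperbolic_dist w z * exp (Re E)"
    unfolding tempered_factor_def E_def[symmetric] norm_mult pseudohyperbolic_dist_def
    by (simp only: norm_exp_eq_Re)
  have s0: "0 \<le> pseudohyperbolic_dist w z" by (simp add: pseudohyperbolic_dist_def)
  have "pseudohyperbolic_dist w z * exp (Re E) \<le> 1 * exp (exponent_bound s)"
    using E complex_Re_le_cmod[of E] pseudohyperbolic_dist_le_1[OF assms]
    by (intro mult_mono) auto
  then show "norm (tempered_factor s w z) \<le> exp (exponent_bound s)" by (simp add: eq)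
  show "pseudohyperbolic_dist w z * exp (- exponent_bound s) \<le> norm (tempered_factor s w z)"
    unfolding eq using E abs_Re_le_cmod[of E] s0 by (intro mult_left_mono) auto
qed

lemma norm_weierstrass_factor_kernel:
  assumes "norm w < 1" "norm z < 1"
  shows "norm (weierstrass_factor s (disc_kernel w z)) = norm w * norm (tempered_factor s w z)"
  unfolding weierstrass_factor_disc_kernel[OF assms] by (simp add: norm_mult)

definition ratio_const :: "nat \<Rightarrow> real" where
  "ratio_const s = 6 + (exponent_bound s + 3) * 2 ^ Suc s"

lemma ratio_const_pos: "0 < ratio_const s"
  unfolding ratio_const_def using exponent_bound_nonneg[of s] by (intro add_pos_nonneg) auto

text \<open>
  Where the kernel exceeds 1/2, any constant is dominated by a multiple of a power of the kernel, so
  the bounded errors made there can be written in the same form as the errors made elsewhere.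
\<close>

lemma large_kernel_absorbs:
  assumes "1 / 2 < norm u" "0 \<le> x"
  shows "x \<le> x * 2 ^ Suc s * norm u ^ Suc s"
proof -
  have "(1 / 2) ^ Suc s \<le> norm u ^ Suc s" using assms by (intro power_mono) auto
  then have "1 \<le> 2 ^ Suc s * norm u ^ Suc s" by (simp add: field_simps)
  then show ?thesis using assms mult_left_mono[of 1 "2 ^ Suc s * norm u ^ Suc s" x]
    by (simp add: mult.assoc)
qed

text \<open>
  If the kernel is at most 1/2 then \<open>|w| \<ge> 1/2\<close> and the elementary factor estimate applies;
  otherwise the crude bound by \<open>exponent_bound\<close> is absorbed. Dividing by \<open>|w|\<close> costs a factor 2.
\<close>

lemma
  assumes wz: "norm w < 1" "norm z < 1" and s: "2 \<le> s"
  defines "a \<equiv> norm (disc_kernel w z) ^ Suc s"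
  defines "c \<equiv> 3 + exponent_bound s * 2 ^ Suc s"
  shows norm_mult_tempered_factor_le_exp: "norm w * norm (tempered_factor s w z) \<le> exp (c * a)"
    and norm_tempered_factor_le_exp: "norm (tempered_factor s w z) \<le> 2 * exp (c * a)"
proof -
  have a0: "0 \<le> a" by (simp add: a_def)
  have h0: "0 \<le> exponent_bound s * 2 ^ Suc s" using exponent_bound_nonneg by simp
  have "norm w * norm (tempered_factor s w z) \<le> exp (c * a) \<and> norm (tempered_factor s w z) \<le> 2 * exp (c * a)"
  proof (cases "norm (disc_kernel w z) \<le> 1 / 2")
    case True
    have "norm w * norm (tempered_factor s w z) \<le> exp (3 * a)"
      using norm_weierstrass_factor_le_exp[OF True s] norm_weierstrass_factor_kernel[OF wz, of s]
      by (simp add: a_def)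
    also have "\<dots> \<le> exp (c * a)" using a0 h0 by (simp add: c_def mult_right_mono)
    finally have 1: "norm w * norm (tempered_factor s w z) \<le> exp (c * a)" .
    have "1 / 2 \<le> norm w" using norm_disc_kernel_ge[OF wz] True by linarith
    then have "1 / 2 * norm (tempered_factor s w z) \<le> norm w * norm (tempered_factor s w z)"
      by (intro mult_right_mono) auto
    then show ?thesis using 1 by linarith
  next
    case False
    have "exponent_bound s \<le> exponent_bound s * 2 ^ Suc s * a"
      unfolding a_def using False exponent_bound_nonneg by (intro large_kernel_absorbs) auto
    also have "\<dots> \<le> c * a" unfolding c_def using a0 by (intro mult_right_mono) auto
    finally have 1: "norm (tempered_factor s w z) \<le> exp (c * a)"
      using norm_tempered_factor_le[OF wz, of s] by (meson exp_le_cancel_iff order_trans)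
    moreover have "norm w * norm (tempered_factor s w z) \<le> norm (tempered_factor s w z)"
      using wz by (intro mult_left_le_one_le) auto
    ultimately show ?thesis using exp_gt_zero[of "c * a"] by linarith
  qed
  then show "norm w * norm (tempered_factor s w z) \<le> exp (c * a)"
    "norm (tempered_factor s w z) \<le> 2 * exp (c * a)" by auto
qed

text \<open>
  The summand of condition (iii) centred at \<open>\<zeta>\<close>, extended by 0 so that it can be summed over all points.
\<close>

definition near_log :: "complex \<Rightarrow> complex \<Rightarrow> real" where
  "near_log \<zeta> w = (if norm (\<zeta> - w) < (1 - norm \<zeta>) / 2 then ln (1 / pseudohyperbolic_dist \<zeta> w) else 0)"

text \<open>
  Points outside the disc of radius \<open>(1 - |\<zeta>|) / 2\<close> around \<open>\<zeta>\<close> have pseudohyperbolic distance at least 1/5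
  from \<open>\<zeta>\<close>; for the others \<open>near_log\<close> records the loss.
\<close>

lemma exp_near_log_ge:
  assumes "norm w < 1" "norm \<zeta> < 1" "w \<noteq> \<zeta>"
  shows "1 \<le> 5 * pseudohyperbolic_dist w \<zeta> * exp (near_log \<zeta> w)"
proof (cases "norm (\<zeta> - w) < (1 - norm \<zeta>) / 2")
  case True
  have "pseudohyperbolic_dist \<zeta> w > 0" using pseudohyperbolic_dist_pos assms by metis
  then show ?thesis using True
    by (simp add: near_log_def pseudohyperbolic_dist_commute[of w \<zeta>])
next
  case False
  have pos: "0 < norm (1 - cnj \<zeta> * w)" by (rule denominator_pos[OF assms(2,1)])
  have "norm (1 - cnj \<zeta> * w) \<le> 5 * norm (\<zeta> - w)"
    using denominator_le[OF assms(2), of w] False by simp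
  then have "1 \<le> 5 * pseudohyperbolic_dist \<zeta> w"
    using pos unfolding pseudohyperbolic_dist_def norm_divide
    by (simp only: times_divide_eq_right le_divide_eq_1_pos)
  then show ?thesis using False
    by (simp add: near_log_def pseudohyperbolic_dist_commute[of w \<zeta>])
qed

lemma near_log_nonneg:
  assumes "norm w < 1" "norm \<zeta> < 1" "w \<noteq> \<zeta>"
  shows "0 \<le> near_log \<zeta> w"
  using pseudohyperbolic_dist_le_1[OF assms(2,1)] pseudohyperbolic_dist_pos[OF assms(2,1)] assms(3)
  by (auto simp: near_log_def intro!: ln_ge_zero)

lemma five_le_exp_2: "5 \<le> exp (2::real)"
proof -
  have "(5::real) / 2 \<le> exp 1"
    using exp_lower_Taylor_quadratic[of 1] by simp
  then have "(5 / 2) * (5 / 2) \<le> exp 1 * exp (1::real)" by (intro mult_mono) auto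
  then show ?thesis unfolding exp_add[symmetric] by simp
qed

text \<open>
  The basic estimate for one factor of the interpolating products. If the kernel at \<open>\<zeta>\<close> is at
  most 1/2, both values are governed by the elementary factor, and the constant \<open>|w|\<close> cancels in the quotient.
  If it is larger, the denominator may be small because \<open>w\<close> is close to \<open>\<zeta>\<close>; its size is
  then that of the pseudohyperbolic distance, which \<open>near_log\<close> compensates.
\<close>

lemma tempered_factor_ratio_le:
  assumes w: "norm w < 1" and z: "norm z < 1" and \<zeta>: "norm \<zeta> < 1" and ne: "w \<noteq> \<zeta>" and s: "2 \<le> s"
  shows "norm (tempered_factor s w z) \<le>
    exp (ratio_const s * (norm (disc_kernel w z) ^ Suc s + norm (disc_kernel w \<zeta>) ^ Suc s) + near_log \<zeta> w)
      * norm (tempered_factor s w \<zeta>)"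
proof -
  define a b c h where "a = norm (disc_kernel w z) ^ Suc s" and "b = norm (disc_kernel w \<zeta>) ^ Suc s"
    and "c = 3 + exponent_bound s * 2 ^ Suc s" and "h = exponent_bound s"
  have ab: "0 \<le> a" "0 \<le> b" by (simp_all add: a_def b_def)
  have h0: "0 \<le> h" using exponent_bound_nonneg by (simp add: h_def)
  have c: "c \<le> ratio_const s" by (simp add: c_def ratio_const_def algebra_simps)
  have ca: "c * a \<le> ratio_const s * a" using c ab by (intro mult_right_mono)
  show ?thesis
  proof (cases "norm (disc_kernel w \<zeta>) \<le> 1 / 2")
    case True
    have w0: "norm w > 0" using norm_disc_kernel_ge[OF w \<zeta>] True by linarith
    have low: "exp (- (6 * b)) \<le> norm w * norm (tempered_factor s w \<zeta>)"
      using exp_le_norm_weierstrass_factor[OF True s] norm_weierstrass_factor_kernel[OF w \<zeta>, of s]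
      by (simp add: b_def)
    have "norm w * norm (tempered_factor s w z) \<le> exp (c * a)"
      using norm_mult_tempered_factor_le_exp[OF w z s] by (simp add: a_def c_def)
    also have "\<dots> = exp (c * a + 6 * b) * exp (- (6 * b))" unfolding exp_add[symmetric] by simp
    also have "\<dots> \<le> exp (c * a + 6 * b) * (norm w * norm (tempered_factor s w \<zeta>))"
      using low by (intro mult_left_mono) auto
    finally have "norm w * norm (tempered_factor s w z)
      \<le> norm w * (exp (c * a + 6 * b) * norm (tempered_factor s w \<zeta>))" by (simp only: mult_ac)
    then have "norm (tempered_factor s w z) \<le> exp (c * a + 6 * b) * norm (tempered_factor s w \<zeta>)"
      using w0 by (simp only: mult_le_cancel_left_pos)
    also have "6 * b \<le> ratio_const s * b"
      using ab h0 unfolding ratio_const_def h_def by (intro mult_right_mono) auto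
    then have "exp (c * a + 6 * b) * norm (tempered_factor s w \<zeta>)
       \<le> exp (ratio_const s * (a + b) + near_log \<zeta> w) * norm (tempered_factor s w \<zeta>)"
      using ca near_log_nonneg[OF w \<zeta> ne] by (intro mult_right_mono) (auto simp: distrib_left)
    finally show ?thesis by (simp only: a_def b_def)
  next
    case False
    define \<sigma> where "\<sigma> = pseudohyperbolic_dist w \<zeta>"
    have s0: "0 < \<sigma>" using pseudohyperbolic_dist_pos[OF w \<zeta> ne] by (simp add: \<sigma>_def)
    have low: "\<sigma> \<le> exp h * norm (tempered_factor s w \<zeta>)"
      using norm_tempered_factor_ge[OF w \<zeta>, of s] by (simp add: \<sigma>_def h_def exp_minus field_simps)
    \<comment> \<open>The constants 2, 5 and \<open>exp h\<close> add up to at most \<open>h + 3\<close> in the exponent, which the large kernel at \<open>\<zeta>\<close> absorbs.\<close>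
    have "norm (tempered_factor s w z) \<le> 2 * exp (c * a)"
      using norm_tempered_factor_le_exp[OF w z s] by (simp add: a_def c_def)
    also have "\<dots> \<le> 2 * exp (c * a) * (5 * \<sigma> * exp (near_log \<zeta> w))"
      using exp_near_log_ge[OF w \<zeta> ne] mult_left_mono[of 1 _ "2 * exp (c * a)"] by (simp add: \<sigma>_def)
    also have "\<dots> = \<sigma> * (2 * 5 * exp (c * a) * exp (near_log \<zeta> w))" by (simp only: mult_ac)
    also have "\<dots> \<le> (exp h * norm (tempered_factor s w \<zeta>)) * (2 * 5 * exp (c * a) * exp (near_log \<zeta> w))"
      using low by (intro mult_right_mono) auto
    also have "\<dots> = norm (tempered_factor s w \<zeta>) * (2 * 5) * (exp h * exp (c * a) * exp (near_log \<zeta> w))"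
      by (simp only: mult_ac)
    also have "\<dots> \<le> norm (tempered_factor s w \<zeta>) * (exp 1 * exp 2) * (exp h * exp (c * a) * exp (near_log \<zeta> w))"
      using five_le_exp_2 exp_ge_add_one_self[of 1]
      by (intro mult_right_mono mult_left_mono mult_mono) auto
    also have "\<dots> = exp (c * a + (h + 3) + near_log \<zeta> w) * norm (tempered_factor s w \<zeta>)"
      by (simp add: exp_add[symmetric] algebra_simps)
    also have "\<dots> \<le> exp (ratio_const s * (a + b) + near_log \<zeta> w) * norm (tempered_factor s w \<zeta>)"
    proof -
      have "h + 3 \<le> (h + 3) * 2 ^ Suc s * b"
        unfolding b_def using False h0 by (intro large_kernel_absorbs) auto
      also have "\<dots> \<le> ratio_const s * b"
        unfolding ratio_const_def h_def using ab by (intro mult_right_mono) auto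
      finally show ?thesis using ca by (intro mult_right_mono) (auto simp: distrib_left)
    qed
    finally show ?thesis by (simp only: a_def b_def)
  qed
qed

lemma tempered_factor_self [simp]: "tempered_factor s w w = 0"
  by (simp add: tempered_factor_def)

lemma tempered_factor_nonzero:
  assumes "norm w < 1" "norm z < 1" "w \<noteq> z"
  shows "tempered_factor s w z \<noteq> 0"
  using denominator_nonzero[OF assms(1,2)] assms(3)
  unfolding tempered_factor_def mult_eq_0_iff divide_eq_0_iff by auto

lemma
  assumes "norm w < 1"
  shows disc_kernel_holomorphic: "disc_kernel w holomorphic_on ball 0 1"
    and tempered_factor_holomorphic: "tempered_factor s w holomorphic_on ball 0 1"
proof -
  have nz: "1 - cnj w * z \<noteq> 0" if "z \<in> ball 0 1" for z
    using denominator_nonzero[OF assms] that by auto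
  show 1: "disc_kernel w holomorphic_on ball 0 1"
    unfolding disc_kernel_def by (intro holomorphic_intros nz)
  have "(\<lambda>z. (w - z) / (1 - cnj w * z) * exp (\<Sum>k=1..s. disc_kernel w z ^ k / of_nat k)) holomorphic_on ball 0 1"
    by (intro holomorphic_intros nz 1) auto
  then show "tempered_factor s w holomorphic_on ball 0 1"
    unfolding tempered_factor_def .
qed

section \<open>Doubling growth functions\<close>

lemma ex_dyadic_interval:
  fixes x :: real assumes "1 \<le> x"
  shows "\<exists>M. 2 ^ M \<le> x \<and> x < 2 ^ Suc M"
proof -
  obtain n where n: "x < 2 ^ n" using real_arch_pow[of 2 x] by auto
  define m where "m = (LEAST n. x < (2::real) ^ n)"
  have m: "x < 2 ^ m" unfolding m_def using n by (rule LeastI)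
  with assms have "m \<noteq> 0" by (cases m) auto
  then obtain M where M: "m = Suc M" by (cases m) auto
  have "\<not> x < 2 ^ M"
    using not_less_Least[of M "\<lambda>n. x < (2::real) ^ n"] M unfolding m_def by simp
  then show ?thesis using m M by (intro exI[of _ M]) auto
qed

lemma sum_lessThan_add:
  fixes f :: "nat \<Rightarrow> real"
  shows "sum f {..<m + n} = sum f {..<m} + (\<Sum>i<n. f (m + i))"
  by (induct n) (simp_all add: add.assoc)

text \<open>
  The second mean value theorem yields the integrability of the product of a monotone function, which may
  have infinitely many jumps, and a continuous one.
\<close>

lemma mono_over_identity_integrable:
  fixes \<psi> :: "real \<Rightarrow> real"
  assumes mono: "mono_on {1..} \<psi>" and a: "1 \<le> a"
  shows "(\<lambda>t. \<psi> t / t) integrable_on {a..b}"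
proof (cases "a \<le> b")
  case True
  have "continuous_on {a..b} (\<lambda>t. 1 / t)" using a by (intro continuous_intros) auto
  then have "(\<lambda>t. 1 / t) integrable_on {a..b}" by (rule integrable_continuous_real)
  moreover have "\<And>x y. \<lbrakk>a \<le> x; x \<le> y; y \<le> b\<rbrakk> \<Longrightarrow> \<psi> x \<le> \<psi> y"
    using a by (intro mono_onD[OF mono]) auto
  ultimately obtain c where
    "((\<lambda>t. \<psi> t * (1 / t)) has_integral
       (\<psi> a * integral {a..c} (\<lambda>t. 1 / t) + \<psi> b * integral {c..b} (\<lambda>t. 1 / t))) {a..b}"
    using True second_mean_value_theorem_full[of "\<lambda>t. 1 / t" a b \<psi>] by blast
  then show ?thesis unfolding integrable_on_def by auto
qed (simp add: integrable_on_empty)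

text \<open>
  The hypotheses on \<open>\<psi>\<close> with constants that serve on all of \<open>[1, \<infinity>)\<close> instead of near infinity.
\<close>

locale doubling_growth =
  fixes \<psi> :: "real \<Rightarrow> real" and D K :: real
  assumes psi_mono: "\<And>x y. 1 \<le> x \<Longrightarrow> x \<le> y \<Longrightarrow> \<psi> x \<le> \<psi> y"
    and psi_pos: "\<And>x. 1 \<le> x \<Longrightarrow> 0 < \<psi> x"
    and psi_doubling: "\<And>x. 1 \<le> x \<Longrightarrow> \<psi> (2 * x) \<le> D * \<psi> x"
    and log_integral_le: "\<And>x. 1 \<le> x \<Longrightarrow> log_integral \<psi> x \<le> K * \<psi> x"
begin

abbreviation psi_at :: "complex \<Rightarrow> real" where
  "psi_at z \<equiv> \<psi> (1 / (1 - norm z))"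

lemma D_ge_1: "1 \<le> D"
proof -
  have "1 * \<psi> 1 \<le> D * \<psi> 1" using psi_mono[of 1 2] psi_doubling[of 1] by simp
  then show ?thesis using psi_pos[of 1] by (simp only: mult_le_cancel_right_pos)
qed

lemma K_nonneg: "0 \<le> K"
proof -
  have "0 * \<psi> 1 \<le> K * \<psi> 1" using log_integral_le[of 1] by (simp add: log_integral_def)
  then show ?thesis using psi_pos[of 1] by (simp only: mult_le_cancel_right_pos)
qed

lemma psi_at_pos: "norm z < 1 \<Longrightarrow> 0 < psi_at z"
  by (rule psi_pos) (simp add: divide_simps)

lemma psi_power_le: "1 \<le> x \<Longrightarrow> \<psi> (2 ^ j * x) \<le> D ^ j * \<psi> x"
proof (induct j)
  case (Suc j)
  have "(1::real) * 1 \<le> 2 ^ j * x" using Suc.prems by (intro mult_mono) auto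
  then have "\<psi> (2 * (2 ^ j * x)) \<le> D * \<psi> (2 ^ j * x)" by (intro psi_doubling) simp
  also have "\<dots> \<le> D * (D ^ j * \<psi> x)" using Suc D_ge_1 by (intro mult_left_mono) auto
  finally show ?case by (simp add: mult_ac)
qed simp

lemma psi_over_identity_integrable:
  assumes "1 \<le> a"
  shows "(\<lambda>t. \<psi> t / t) integrable_on {a..b}"
  by (rule mono_over_identity_integrable[OF _ assms]) (auto intro: mono_onI psi_mono)

text \<open>
  On each dyadic interval \<open>\<psi>\<close> is at least its value at the left end, and \<open>1 / t\<close> has integral \<open>ln 2\<close>.
\<close>

lemma dyadic_sum_le_log_integral: "(\<Sum>k<N. \<psi> (2 ^ k)) * ln 2 \<le> log_integral \<psi> (2 ^ N)"
proof (induct N)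
  case 0 then show ?case by (simp add: log_integral_def)
next
  case (Suc N)
  define a where "a = (2::real) ^ N"
  have a: "1 \<le> a" by (simp add: a_def)
  have "((\<lambda>t. \<psi> a * (1 / t)) has_integral (\<psi> a * (ln (2 * a) - ln a))) {a..2 * a}"
  proof (intro has_integral_mult_right fundamental_theorem_of_calculus)
    fix t assume "t \<in> {a..2 * a}"
    then have "t > 0" using a by auto
    then show "(ln has_vector_derivative 1 / t) (at t within {a..2 * a})"
      using has_vector_derivative_at_within has_real_derivative_iff_has_vector_derivative
        DERIV_ln_divide by blast
  qed (use a in auto)
  moreover have "ln (2 * a) - ln a = ln 2" using a by (simp add: ln_mult)
  ultimately have int: "((\<lambda>t. \<psi> a * (1 / t)) has_integral (\<psi> a * ln 2)) {a..2 * a}" by simp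
  have "\<psi> a * ln 2 = integral {a..2 * a} (\<lambda>t. \<psi> a * (1 / t))" using int by (simp add: integral_unique)
  also have "\<dots> \<le> integral {a..2 * a} (\<lambda>t. \<psi> t / t)"
  proof (rule integral_le)
    show "\<psi> a * (1 / t) \<le> \<psi> t / t" if "t \<in> {a..2 * a}" for t
      using that a psi_mono[of a t] by (auto intro!: divide_right_mono)
  qed (use int a psi_over_identity_integrable in auto)
  finally have step: "\<psi> a * ln 2 \<le> integral {a..2 * a} (\<lambda>t. \<psi> t / t)" .
  have "integral {1..a} (\<lambda>t. \<psi> t / t) + integral {a..2 * a} (\<lambda>t. \<psi> t / t)
      = integral {1..2 * a} (\<lambda>t. \<psi> t / t)"
    by (rule Henstock_Kurzweil_Integration.integral_combine)
       (use a psi_over_identity_integrable[of 1] in auto)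
  then show ?case using Suc step by (simp add: log_integral_def a_def algebra_simps)
qed

lemma dyadic_sum_le: "(\<Sum>k<Suc M. \<psi> (2 ^ k)) \<le> K * D / ln 2 * \<psi> (2 ^ M)"
proof -
  have "(\<Sum>k<Suc M. \<psi> (2 ^ k)) * ln 2 \<le> K * \<psi> (2 ^ Suc M)"
    using dyadic_sum_le_log_integral[of "Suc M"] log_integral_le[OF one_le_power[of 2 "Suc M"]]
    by linarith
  also have "\<dots> \<le> K * (D * \<psi> (2 ^ M))"
    using psi_doubling[of "2 ^ M"] K_nonneg by (intro mult_left_mono) auto
  finally show ?thesis by (simp add: field_simps)
qed

definition dyadic_const :: real where "dyadic_const = K * D / ln 2 + 2 * D"

lemma dyadic_const_pos: "0 < dyadic_const"
  unfolding dyadic_const_def using K_nonneg D_ge_1 by (intro add_nonneg_pos) auto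

text \<open>
  The sum of \<open>\<psi>\<close> over dyadic scales above the distance \<open>d\<close> to the circle is controlled by the logarithmic
  integral. At the scales below \<open>d\<close> the function \<open>\<psi>\<close> grows by a factor of at most \<open>D\<close> per step, and the
  damping with \<open>2 ^ q \<ge> 2 * D\<close> turns this part into a geometric series.
\<close>

lemma damped_dyadic_sum_le:
  assumes q: "2 * D \<le> 2 ^ q" and d: "0 < d" "d \<le> 1"
  shows "(\<Sum>k<N. \<psi> (2 ^ k) * min 1 (1 / 2 ^ k / d) ^ q) \<le> dyadic_const * \<psi> (1 / d)"
proof -
  obtain M where M: "2 ^ M \<le> 1 / d" "1 / d < 2 ^ Suc M"
    using ex_dyadic_interval[of "1 / d"] d by auto
  define t where "t k = \<psi> (2 ^ k) * min 1 (1 / 2 ^ k / d) ^ q" for k :: nat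
  have t0: "0 \<le> t k" for k
    using psi_pos[of "2 ^ k"] d unfolding t_def by (intro mult_nonneg_nonneg) auto
  have small: "t k \<le> \<psi> (2 ^ k)" for k
  proof -
    have "min 1 (1 / 2 ^ k / d) ^ q \<le> 1" using d by (intro power_le_one) auto
    then show ?thesis unfolding t_def using psi_pos[of "2 ^ k"] by (intro mult_left_le) auto
  qed
  have large: "t (Suc M + i) \<le> D * \<psi> (2 ^ M) * (1 / 2) ^ i" for i
  proof -
    have "1 / 2 ^ (Suc M + i) / d = (1 / d) / 2 ^ (Suc M + i)" by simp
    also have "\<dots> \<le> 2 ^ Suc M / 2 ^ (Suc M + i)" using M by (intro divide_right_mono) auto
    also have "\<dots> = 1 / 2 ^ i" by (simp add: power_add)
    finally have "min 1 (1 / 2 ^ (Suc M + i) / d) ^ q \<le> (1 / 2 ^ i) ^ q"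
      using d by (intro power_mono) auto
    moreover have "\<psi> (2 ^ (Suc M + i)) \<le> D ^ Suc i * \<psi> (2 ^ M)"
      using psi_power_le[of "2 ^ M" "Suc i"] by (simp add: power_add mult_ac)
    ultimately have "t (Suc M + i) \<le> (D ^ Suc i * \<psi> (2 ^ M)) * (1 / 2 ^ i) ^ q"
      unfolding t_def using psi_pos[of "2 ^ M"] D_ge_1 d
      by (intro mult_mono) auto
    also have "(1 / 2 ^ i) ^ q = (1 / (2::real) ^ q) ^ i"
      by (simp add: power_divide power_mult[symmetric] mult.commute)
    also have "(D ^ Suc i * \<psi> (2 ^ M)) * (1 / 2 ^ q) ^ i = D * \<psi> (2 ^ M) * (D / 2 ^ q) ^ i"
      by (simp add: power_divide)
    also have "\<dots> \<le> D * \<psi> (2 ^ M) * (1 / 2) ^ i"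
      using q D_ge_1 psi_pos[of "2 ^ M"]
      by (intro mult_left_mono power_mono) (auto simp: divide_simps)
    finally show ?thesis .
  qed
  have "(\<Sum>k<N. t k) \<le> (\<Sum>k<Suc M + N. t k)"
    using t0 by (intro sum_mono2) auto
  also have "\<dots> = (\<Sum>k<Suc M. t k) + (\<Sum>i<N. t (Suc M + i))" by (rule sum_lessThan_add)
  also have "\<dots> \<le> (\<Sum>k<Suc M. \<psi> (2 ^ k)) + (\<Sum>i<N. D * \<psi> (2 ^ M) * (1 / 2) ^ i)"
    using small large by (intro add_mono sum_mono) auto
  also have "(\<Sum>i<N. D * \<psi> (2 ^ M) * (1 / 2) ^ i) = D * \<psi> (2 ^ M) * (\<Sum>i<N. (1 / 2) ^ i)"
    by (simp add: sum_distrib_left)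
  also have "(\<Sum>i<N. (1 / 2 :: real) ^ i) \<le> 2"
    using geometric_sum[of "1/2::real" N] by simp
  also have "(\<Sum>k<Suc M. \<psi> (2 ^ k)) \<le> K * D / ln 2 * \<psi> (2 ^ M)" by (rule dyadic_sum_le)
  finally have "(\<Sum>k<N. t k) \<le> dyadic_const * \<psi> (2 ^ M)"
    using psi_pos[of "2 ^ M"] D_ge_1 by (simp add: dyadic_const_def algebra_simps)
  also have "\<dots> \<le> dyadic_const * \<psi> (1 / d)"
    using M psi_mono[of "2 ^ M" "1 / d"] dyadic_const_pos by (intro mult_left_mono) auto
  finally show ?thesis by (simp add: t_def)
qed

end

text \<open>
  On the bounded interval where the asymptotic bound says nothing, monotonicity bounds \<open>f\<close> by a
  constant and \<open>\<psi>\<close> from below by \<open>\<psi> 1 > 0\<close>.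
\<close>

lemma bigo_imp_le_everywhere:
  fixes f \<psi> :: "real \<Rightarrow> real"
  assumes mono: "mono_on {1..} \<psi>" and pos: "\<And>x. 1 \<le> x \<Longrightarrow> 0 < \<psi> x"
    and f: "mono_on {1..} f" and O: "f \<in> O[at_top](\<psi>)"
  shows "\<exists>c. \<forall>x\<ge>1. f x \<le> c * \<psi> x"
proof -
  obtain c where c: "c > 0" "\<forall>\<^sub>F x in at_top. norm (f x) \<le> c * norm (\<psi> x)"
    using O by (rule landau_o.bigE)
  then obtain X where X: "\<And>x. X \<le> x \<Longrightarrow> \<bar>f x\<bar> \<le> c * \<bar>\<psi> x\<bar>"
    by (auto simp: eventually_at_top_linorder)
  define Y where "Y = max 1 X"
  define e where "e = \<bar>f Y\<bar> / \<psi> 1"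
  have e: "e \<ge> 0" using pos[of 1] by (simp add: e_def)
  have "f x \<le> (c + e) * \<psi> x" if x: "1 \<le> x" for x
  proof (cases "Y \<le> x")
    case True
    then have "f x \<le> c * \<psi> x" using X[of x] pos[OF x] by (simp add: Y_def)
    moreover have "0 \<le> e * \<psi> x" using e pos[OF x] by simp
    ultimately show ?thesis by (simp add: distrib_right)
  next
    case False
    have "f x \<le> f Y" using x False by (intro mono_onD[OF f]) (auto simp: Y_def)
    also have "\<dots> \<le> e * \<psi> 1" using pos[of 1] by (simp add: e_def)
    also have "\<dots> \<le> e * \<psi> x" using x e by (intro mult_left_mono mono_onD[OF mono]) auto
    finally have "f x \<le> e * \<psi> x" .
    moreover have "0 \<le> c * \<psi> x" using c pos[OF x] by simp
    ultimately show ?thesis by (simp add: distrib_right)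
  qed
  then show ?thesis by blast
qed

lemma class_R_doubling_growth:
  assumes R: "\<psi> \<in> class_R" and dbl: "(\<lambda>x. \<psi> (2 * x)) \<in> O[at_top](\<psi>)"
  shows "\<exists>D K. doubling_growth \<psi> D K"
proof -
  have mono: "mono_on {1..} \<psi>" and pos: "\<And>x. 1 \<le> x \<Longrightarrow> 0 < \<psi> x"
      and O: "log_integral \<psi> \<in> O[at_top](\<psi>)"
    using R by (auto simp: class_R_def)
  have "mono_on {1..} (\<lambda>x. \<psi> (2 * x))"
    by (intro mono_onI mono_onD[OF mono]) auto
  then obtain D where D: "\<And>x. 1 \<le> x \<Longrightarrow> \<psi> (2 * x) \<le> D * \<psi> x"
    using bigo_imp_le_everywhere[OF mono pos _ dbl] by blast
  have "mono_on {1..} (log_integral \<psi>)"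
  proof (rule mono_onI)
    fix x y :: real assume "x \<in> {1..}" "y \<in> {1..}" "x \<le> y"
    then show "log_integral \<psi> x \<le> log_integral \<psi> y"
      unfolding log_integral_def
      by (intro integral_subset_le mono_over_identity_integrable[OF mono])
         (auto intro!: divide_nonneg_nonneg less_imp_le[OF pos])
  qed
  then obtain K where K: "\<And>x. 1 \<le> x \<Longrightarrow> log_integral \<psi> x \<le> K * \<psi> x"
    using bigo_imp_le_everywhere[OF mono pos _ O] by blast
  have "doubling_growth \<psi> D K"
    by unfold_locales (use D K pos in \<open>auto intro: mono_onD[OF mono]\<close>)
  then show ?thesis by blast
qed

section \<open>Sums of kernel powers over a sequence\<close>

lemma sum_inverse_squares_le: "(\<Sum>n<N. 1 / (1 + real n)\<^sup>2) \<le> 2"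
proof -
  have "(\<Sum>n<Suc N. 1 / (1 + real n)\<^sup>2) \<le> 2 - 1 / (1 + real N)" for N
  proof (induct N)
    case (Suc N)
    have "1 / (2 + real N)\<^sup>2 \<le> 1 / ((1 + real N) * (2 + real N))"
      by (intro divide_left_mono) (auto simp: power2_eq_square intro!: mult_right_mono)
    also have "\<dots> = 1 / (1 + real N) - 1 / (2 + real N)"
      by (simp add: field_simps)
    finally show ?case using Suc by simp
  qed simp
  moreover have "(\<Sum>n<N. 1 / (1 + real n)\<^sup>2) \<le> (\<Sum>n<Suc N. 1 / (1 + real n)\<^sup>2)" by simp
  ultimately show ?thesis
    by (smt (verit) divide_nonneg_nonneg of_nat_0_le_iff)
qed

lemma sum_inverse_squares_int_le:
  fixes A :: "int set" and c :: int
  assumes "finite A"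
  shows "(\<Sum>a\<in>A. 1 / (1 + real_of_int \<bar>a - c\<bar>)\<^sup>2) \<le> 4"
proof -
  have half: "(\<Sum>a\<in>B. 1 / (1 + real_of_int \<bar>a - c\<bar>)\<^sup>2) \<le> 2"
    if B: "finite B" "inj_on (\<lambda>a. nat \<bar>a - c\<bar>) B" for B
  proof -
    obtain N where N: "(\<lambda>a. nat \<bar>a - c\<bar>) ` B \<subseteq> {..<N}"
      using B finite_nat_iff_bounded by blast
    have "(\<Sum>a\<in>B. 1 / (1 + real_of_int \<bar>a - c\<bar>)\<^sup>2)
        = (\<Sum>n\<in>(\<lambda>a. nat \<bar>a - c\<bar>) ` B. 1 / (1 + real n)\<^sup>2)"
      by (simp add: sum.reindex[OF B(2)])
    also have "\<dots> \<le> (\<Sum>n<N. 1 / (1 + real n)\<^sup>2)" using N by (intro sum_mono2) auto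
    finally show ?thesis using sum_inverse_squares_le[of N] by linarith
  qed
  have "(\<Sum>a\<in>A. 1 / (1 + real_of_int \<bar>a - c\<bar>)\<^sup>2)
      = (\<Sum>a\<in>A \<inter> {c..}. 1 / (1 + real_of_int \<bar>a - c\<bar>)\<^sup>2)
        + (\<Sum>a\<in>A - {c..}. 1 / (1 + real_of_int \<bar>a - c\<bar>)\<^sup>2)"
    using assms by (rule sum.Int_Diff)
  moreover have "inj_on (\<lambda>a. nat \<bar>a - c\<bar>) (A \<inter> {c..})" "inj_on (\<lambda>a. nat \<bar>a - c\<bar>) (A - {c..})"
    by (auto simp: inj_on_def)
  ultimately show ?thesis
    using half[of "A \<inter> {c..}"] half[of "A - {c..}"] assms by simp
qed

context doubling_growth
begin

text \<open>
  The key summation. Sort the points by dyadic distance \<open>2 ^ (-k)\<close> to the circle, and those of one level by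
  the cells of a square grid of mesh \<open>2 ^ (-k-4)\<close>. All points of a cell lie in the disc of radius
  \<open>(1 - |z\<^sub>i|) / 2\<close> around any one \<open>z\<^sub>i\<close> of them, so the hypothesis bounds their number by a multiple of
  \<open>\<psi> (2 ^ k)\<close>. Of the \<open>q + 4\<close> powers of the kernel, four make the sum over the cells of one level converge,
  as the kernel is at most 128 divided by the grid distance in either coordinate; the other \<open>q\<close>
  supply the damping of the sum over the levels.
\<close>

lemma kernel_power_sum_le:
  fixes z :: "nat \<Rightarrow> complex" and B :: real
  assumes z: "\<And>n. norm (z n) < 1"
    and q: "2 * D \<le> 2 ^ q"
    and B: "\<And>n F. finite F \<Longrightarrow> F \<subseteq> {j. norm (z n - z j) < (1 - norm (z n)) / 2} \<Longrightarrow>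
              real (card F) \<le> B * psi_at (z n)"
  shows "\<exists>C>0. \<forall>\<zeta> F. norm \<zeta> < 1 \<longrightarrow> finite F \<longrightarrow>
           (\<Sum>j\<in>F. norm (disc_kernel (z j) \<zeta>) ^ (q + 4)) \<le> C * psi_at \<zeta>"
proof -
  have "0 \<le> B * psi_at (z 0)" using B[of "{}" 0] by simp
  then have B0: "0 \<le> B" using psi_at_pos[OF z[of 0]] by (simp add: zero_le_mult_iff)
  have "\<exists>k. 2 ^ k \<le> 1 / (1 - norm (z j)) \<and> 1 / (1 - norm (z j)) < 2 ^ Suc k" for j
    using z[of j] by (intro ex_dyadic_interval) (simp add: divide_simps)
  then obtain lev where lev: "\<And>j. 2 ^ lev j \<le> 1 / (1 - norm (z j))"
      "\<And>j. 1 / (1 - norm (z j)) < 2 ^ Suc (lev j)" by metis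
  \<comment> \<open>The level of a point is the dyadic exponent of \<open>1 / (1 - |z j|)\<close>.\<close>
  have lev1: "1 - norm (z j) \<le> 1 / 2 ^ lev j" for j
    using lev(1)[of j] z[of j] by (simp add: field_simps)
  have lev2: "1 / 2 ^ lev j < 2 * (1 - norm (z j))" for j
    using lev(2)[of j] z[of j] by (simp add: field_simps)
  define cell where "cell j = (lev j, \<lfloor>2 ^ (lev j + 4) * Re (z j)\<rfloor>, \<lfloor>2 ^ (lev j + 4) * Im (z j)\<rfloor>)" for j
  have near: "norm (z i - z j) < (1 - norm (z i)) / 2" if "cell i = cell j" for i j
  proof -
    define P where "P = (2::real) ^ (lev i + 4)"
    have P: "P > 0" by (simp add: P_def)
    have l: "lev i = lev j" using that by (simp add: cell_def)
    have "\<bar>P * Re (z i) - P * Re (z j)\<bar> < 1" "\<bar>P * Im (z i) - P * Im (z j)\<bar> < 1"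
      using that l unfolding cell_def P_def by (simp_all, linarith+)
    then have "P * \<bar>Re (z i - z j)\<bar> + P * \<bar>Im (z i - z j)\<bar> < 2"
      using P by (simp add: right_diff_distrib[symmetric] abs_mult)
    moreover have "P * norm (z i - z j) \<le> P * \<bar>Re (z i - z j)\<bar> + P * \<bar>Im (z i - z j)\<bar>"
      using P cmod_le[of "z i - z j"] by (simp add: distrib_left[symmetric] del: minus_complex.sel)
    ultimately have "P * norm (z i - z j) < 2" by linarith
    then have "norm (z i - z j) < 2 / P" using P by (simp add: field_simps)
    also have "2 / P = (1 / 2 ^ lev i) / 8" by (simp add: P_def power_add)
    also have "\<dots> < 2 * (1 - norm (z i)) / 8" using lev2[of i] by (rule divide_strict_right_mono) simp
    also have "\<dots> < (1 - norm (z i)) / 2" using z[of i] by (simp add: field_simps)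
    finally show ?thesis .
  qed
  have card_cell: "real (card {j\<in>F. cell j = (k, a, b)}) \<le> B * D * \<psi> (2 ^ k)" if "finite F" for F k a b
  proof (cases "{j\<in>F. cell j = (k, a, b)} = {}")
    case True
    show ?thesis unfolding True using B0 D_ge_1 psi_pos[of "2 ^ k"] by simp
  next
    case False
    then obtain i where i: "i \<in> F" "cell i = (k, a, b)" by auto
    have "real (card {j\<in>F. cell j = (k, a, b)}) \<le> B * psi_at (z i)"
      using that i near[of i] by (intro B) auto
    also have "psi_at (z i) \<le> \<psi> (2 * 2 ^ k)"
      using i lev[of i] z[of i] by (intro psi_mono) (auto simp: cell_def divide_simps)
    also have "\<dots> \<le> D * \<psi> (2 ^ k)" by (rule psi_doubling) simp
    finally show ?thesis using B0 by (simp add: mult_left_mono mult.assoc)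
  qed
  define C where "C = B * D * 2 ^ q * 128 ^ 4 * 16 * dyadic_const"
  have "(\<Sum>j\<in>F. norm (disc_kernel (z j) \<zeta>) ^ (q + 4)) \<le> C * psi_at \<zeta>"
    if zeta: "norm \<zeta> < 1" and F: "finite F" for \<zeta> F
  proof -
    define d where "d = 1 - norm \<zeta>"
    have d: "0 < d" "d \<le> 1" using zeta by (auto simp: d_def)
    define re im where "re k = \<lfloor>2 ^ (k + 4) * Re \<zeta>\<rfloor>" and "im k = \<lfloor>2 ^ (k + 4) * Im \<zeta>\<rfloor>" for k :: nat
    define m where "m k = min 1 (1 / 2 ^ k / d) ^ q" for k :: nat
    have m0: "0 \<le> m k" for k using d by (simp add: m_def)
    define u where "u c a = 1 / (1 + real_of_int \<bar>a - c\<bar>)\<^sup>2" for a c :: int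
    have u0: "0 \<le> u c a" for c a by (simp add: u_def)
    define W where "W c = (case c of (k, a, b) \<Rightarrow> 2 ^ q * m k * 128 ^ 4 * (u (re k) a * u (im k) b))"
      for c :: "nat \<times> int \<times> int"
    have W0: "0 \<le> W c" for c using m0 u0 by (cases c) (simp add: W_def)
    have summand: "norm (disc_kernel (z j) \<zeta>) ^ (q + 4) \<le> W (cell j)" for j
    proof -
      define k where "k = lev j"
      define P where "P = (2::real) ^ (k + 4)"
      define X where "X = norm (1 - cnj (z j) * \<zeta>)"
      have P: "P > 0" by (simp add: P_def)
      have X: "X > 0" using denominator_pos[OF z zeta] by (simp add: X_def)
      have X1: "1 \<le> P * X"
      proof -
        have "1 / 2 ^ k < 2 * X"
          using lev2[of j] boundary_dist_le_denominator[OF z zeta, of j] by (simp add: X_def k_def)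
        then have "1 < 2 ^ k * (2 * X)" by (simp add: field_simps)
        then show ?thesis using X unfolding P_def by (simp add: power_add)
      qed
      have dist: "norm (z j - \<zeta>) \<le> X"
        unfolding X_def by (rule norm_diff_le_denominator[OF z zeta])
      \<comment> \<open>Rounding to grid cells changes a coordinate difference by less than 1, which \<open>P * X \<ge> 1\<close> dominates.\<close>
      have offset: "1 + real_of_int \<bar>\<lfloor>P * x\<rfloor> - \<lfloor>P * y\<rfloor>\<bar> \<le> 2 * (P * X) + 1" if "\<bar>x - y\<bar> \<le> X" for x y
      proof -
        have "\<bar>P * x - P * y\<bar> \<le> P * X"
          using that P by (simp add: right_diff_distrib[symmetric] abs_mult)
        then show ?thesis using X1 by linarith
      qed
      have shape: "norm (disc_kernel (z j) \<zeta>) * (1 + real_of_int \<bar>\<lfloor>P * x\<rfloor> - \<lfloor>P * y\<rfloor>\<bar>) \<le> 128"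
        if "\<bar>x - y\<bar> \<le> X" for x y
      proof -
        have "norm (disc_kernel (z j) \<zeta>) \<le> 2 * (1 - norm (z j)) / X"
          using norm_disc_kernel_le[OF z zeta X] by (simp add: X_def)
        also have "\<dots> \<le> 2 * (1 / 2 ^ k) / X"
          using lev1[of j] X by (intro divide_right_mono mult_left_mono) (auto simp: k_def)
        also have "\<dots> = 32 / (P * X)" by (simp add: P_def power_add)
        finally have "norm (disc_kernel (z j) \<zeta>) * (1 + real_of_int \<bar>\<lfloor>P * x\<rfloor> - \<lfloor>P * y\<rfloor>\<bar>)
            \<le> 32 / (P * X) * (4 * (P * X))"
          using offset[OF that] X1 by (intro mult_mono) auto
        then show ?thesis using P X by simp
      qed
      have cellj: "cell j = (k, \<lfloor>P * Re (z j)\<rfloor>, \<lfloor>P * Im (z j)\<rfloor>)"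
        by (simp add: cell_def k_def P_def)
      define s t where "s = 1 + real_of_int \<bar>\<lfloor>P * Re (z j)\<rfloor> - re k\<bar>"
        and "t = 1 + real_of_int \<bar>\<lfloor>P * Im (z j)\<rfloor> - im k\<bar>"
      have st: "s > 0" "t > 0" by (auto simp: s_def t_def)
      define A where "A = norm (disc_kernel (z j) \<zeta>)"
      have A0: "A \<ge> 0" by (simp add: A_def)
      have "A * s \<le> 128" "A * t \<le> 128"
        using shape[of "Re (z j)" "Re \<zeta>"] shape[of "Im (z j)" "Im \<zeta>"] dist
          abs_Re_le_cmod[of "z j - \<zeta>"] abs_Im_le_cmod[of "z j - \<zeta>"]
        by (auto simp: A_def s_def t_def re_def im_def P_def)
      then have "(A * s)\<^sup>2 * (A * t)\<^sup>2 \<le> 128\<^sup>2 * 128\<^sup>2"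
        using A0 st by (intro mult_mono power_mono) auto
      then have A4: "A ^ 4 \<le> 128 ^ 4 * ((1 / s\<^sup>2) * (1 / t\<^sup>2))"
        using st by (simp add: field_simps power2_eq_square eval_nat_numeral)
      have "A \<le> 2 * min 1 (1 / 2 ^ k / d)"
      proof -
        have "A \<le> 2" unfolding A_def by (rule norm_disc_kernel_le_2[OF z zeta])
        moreover have "A \<le> 2 * ((1 - norm (z j)) / d)"
          unfolding A_def d_def by (rule norm_disc_kernel_le_quotient[OF z zeta])
        moreover have "(1 - norm (z j)) / d \<le> 1 / 2 ^ k / d"
          using lev1[of j] d by (intro divide_right_mono) (auto simp: k_def)
        ultimately show ?thesis by linarith
      qed
      then have "A ^ q \<le> 2 ^ q * m k"
        using A0 unfolding m_def power_mult_distrib[symmetric] by (intro power_mono) auto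
      then have "A ^ q * A ^ 4 \<le> (2 ^ q * m k) * (128 ^ 4 * ((1 / s\<^sup>2) * (1 / t\<^sup>2)))"
        using A4 A0 m0 by (intro mult_mono) auto
      then show ?thesis
        by (simp add: A_def W_def cellj u_def s_def t_def power_add mult.assoc)
    qed
    have card_cell': "real (card {j\<in>F. cell j = c}) \<le> B * D * \<psi> (2 ^ fst c)" for c
      using card_cell[OF F] by (cases c) simp
    obtain N where N: "lev ` F \<subseteq> {..<N}" using F finite_nat_iff_bounded by blast
    define Sa Sb where "Sa = (\<lambda>j. fst (snd (cell j))) ` F" and "Sb = (\<lambda>j. snd (snd (cell j))) ` F"
    have cells: "cell ` F \<subseteq> {..<N} \<times> Sa \<times> Sb"
      using N unfolding Sa_def Sb_def by (auto simp: cell_def)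
    have "(\<Sum>j\<in>F. norm (disc_kernel (z j) \<zeta>) ^ (q + 4)) \<le> (\<Sum>j\<in>F. W (cell j))"
      by (intro sum_mono summand)
    also have "\<dots> = (\<Sum>c\<in>cell ` F. \<Sum>j\<in>{j\<in>F. cell j = c}. W (cell j))"
      by (rule sum.image_gen[OF F])
    also have "\<dots> = (\<Sum>c\<in>cell ` F. real (card {j\<in>F. cell j = c}) * W c)"
      by simp
    also have "\<dots> \<le> (\<Sum>c\<in>cell ` F. (B * D * \<psi> (2 ^ fst c)) * W c)"
      by (intro sum_mono mult_right_mono card_cell' W0)
    also have "\<dots> \<le> (\<Sum>c\<in>{..<N} \<times> Sa \<times> Sb. (B * D * \<psi> (2 ^ fst c)) * W c)"
    proof (intro sum_mono2 cells)
      show "finite ({..<N} \<times> Sa \<times> Sb)" using F by (simp add: Sa_def Sb_def)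
      show "0 \<le> (B * D * \<psi> (2 ^ fst c)) * W c" for c
        using B0 D_ge_1 psi_pos[of "2 ^ fst c"] W0 by (intro mult_nonneg_nonneg) auto
    qed
    also have "\<dots> = (\<Sum>k<N. \<Sum>a\<in>Sa. \<Sum>b\<in>Sb.
        (B * D * \<psi> (2 ^ k)) * (2 ^ q * m k * 128 ^ 4 * (u (re k) a * u (im k) b)))"
      by (simp add: sum.cartesian_product W_def case_prod_unfold)
    also have "\<dots> = (\<Sum>k<N. B * D * 2 ^ q * 128 ^ 4 * (\<psi> (2 ^ k) * m k) *
        ((\<Sum>a\<in>Sa. u (re k) a) * (\<Sum>b\<in>Sb. u (im k) b)))"
    proof (intro sum.cong refl)
      fix k
      have "(\<Sum>a\<in>Sa. \<Sum>b\<in>Sb. (B * D * \<psi> (2 ^ k)) * (2 ^ q * m k * 128 ^ 4 * (u (re k) a * u (im k) b)))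
          = (\<Sum>a\<in>Sa. \<Sum>b\<in>Sb. (B * D * 2 ^ q * 128 ^ 4 * (\<psi> (2 ^ k) * m k)) * (u (re k) a * u (im k) b))"
        by (simp only: mult_ac)
      then show "(\<Sum>a\<in>Sa. \<Sum>b\<in>Sb. (B * D * \<psi> (2 ^ k)) * (2 ^ q * m k * 128 ^ 4 * (u (re k) a * u (im k) b)))
          = B * D * 2 ^ q * 128 ^ 4 * (\<psi> (2 ^ k) * m k) * ((\<Sum>a\<in>Sa. u (re k) a) * (\<Sum>b\<in>Sb. u (im k) b))"
        unfolding sum_product by (simp only: sum_distrib_left)
    qed
    also have "\<dots> \<le> (\<Sum>k<N. B * D * 2 ^ q * 128 ^ 4 * (\<psi> (2 ^ k) * m k) * (4 * 4))"
    proof (intro sum_mono mult_left_mono mult_mono)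
      fix k
      show "(\<Sum>a\<in>Sa. u (re k) a) \<le> 4"
        unfolding u_def Sa_def by (rule sum_inverse_squares_int_le[OF finite_imageI[OF F]])
      show "(\<Sum>b\<in>Sb. u (im k) b) \<le> 4"
        unfolding u_def Sb_def by (rule sum_inverse_squares_int_le[OF finite_imageI[OF F]])
      show "0 \<le> B * D * 2 ^ q * 128 ^ 4 * (\<psi> (2 ^ k) * m k)"
        using B0 D_ge_1 m0 psi_pos[of "2 ^ k"] by (intro mult_nonneg_nonneg) auto
    qed (use u0 in \<open>auto intro!: sum_nonneg\<close>)
    also have "\<dots> = B * D * 2 ^ q * 128 ^ 4 * 16 * (\<Sum>k<N. \<psi> (2 ^ k) * m k)"
      unfolding sum_distrib_left by (rule sum.cong) (simp_all add: mult_ac)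
    also have "(\<Sum>k<N. \<psi> (2 ^ k) * m k) \<le> dyadic_const * \<psi> (1 / d)"
      unfolding m_def by (rule damped_dyadic_sum_le[OF q d])
    finally show ?thesis
      using B0 D_ge_1 by (simp add: C_def d_def mult_left_mono mult.assoc)
  qed
  moreover have "C * psi_at \<zeta> \<le> (C + 1) * psi_at \<zeta>" if "norm \<zeta> < 1" for \<zeta>
    using psi_at_pos[OF that] by (intro mult_right_mono) auto
  moreover have "C + 1 > 0" unfolding C_def using B0 D_ge_1 dyadic_const_pos
    by (intro add_nonneg_pos mult_nonneg_nonneg) auto
  ultimately show ?thesis by (meson order_trans)
qed

end

section \<open>Interpolation by finite sums and normal families\<close>

lemma eln_le_iff: "0 \<le> x \<Longrightarrow> eln x \<le> ereal y \<longleftrightarrow> x \<le> exp y"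
proof (cases "x = 0")
  case False
  moreover assume "0 \<le> x"
  ultimately have "exp (ln x) = x" by simp
  then have "x \<le> exp y \<longleftrightarrow> ln x \<le> y" using exp_le_cancel_iff[of "ln x" y] by simp
  then show ?thesis using False by (simp add: eln_def)
qed (simp add: eln_def)

lemma max_modulus_le:
  assumes "0 < r" "\<And>\<zeta>. norm \<zeta> = r \<Longrightarrow> norm (f \<zeta>) \<le> B"
  shows "0 \<le> max_modulus r f" "max_modulus r f \<le> B"
proof -
  have ne: "complex_of_real r \<in> {z. norm z = r}" using assms(1) by simp
  show "max_modulus r f \<le> B"
    unfolding max_modulus_def
  proof (rule cSUP_least)
    show "{z. norm z = r} \<noteq> ({} :: complex set)" using ne by (metis empty_iff)
    show "norm (f z) \<le> B" if "z \<in> {z. norm z = r}" for z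
      using that by (intro assms(2)) simp
  qed
  have "bdd_above ((\<lambda>z. norm (f z)) ` {z. norm z = r})"
    using assms(2) by (auto intro!: bdd_aboveI)
  then have "norm (f (of_real r)) \<le> max_modulus r f"
    unfolding max_modulus_def using ne by (intro cSUP_upper) auto
  then show "0 \<le> max_modulus r f" using norm_ge_zero order_trans by blast
qed

context doubling_growth
begin

text \<open>
  A single level of \<open>damped_dyadic_sum_le\<close>. It makes \<open>psi_at w\<close> times the \<open>q\<close>-th power of the kernel
  the exponent of a peak function that does not outgrow \<open>psi_at \<zeta>\<close>.
\<close>

lemma psi_at_mult_kernel_power_le:
  assumes w: "norm w < 1" and \<zeta>: "norm \<zeta> < 1" and q: "2 * D \<le> 2 ^ q"
  shows "psi_at w * norm (disc_kernel w \<zeta>) ^ q \<le> D * 2 ^ q * dyadic_const * psi_at \<zeta>"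
proof -
  define d where "d = 1 - norm \<zeta>"
  have d: "0 < d" "d \<le> 1" using \<zeta> by (auto simp: d_def)
  obtain k where k: "2 ^ k \<le> 1 / (1 - norm w)" "1 / (1 - norm w) < 2 ^ Suc k"
    using ex_dyadic_interval[of "1 / (1 - norm w)"] w by (auto simp: divide_simps)
  have k1: "1 - norm w \<le> 1 / 2 ^ k" using k(1) w by (simp add: field_simps)
  have "norm (disc_kernel w \<zeta>) \<le> 2 * min 1 (1 / 2 ^ k / d)"
  proof -
    have "(1 - norm w) / d \<le> 1 / 2 ^ k / d"
      using k1 d by (intro divide_right_mono) auto
    then show ?thesis
      using norm_disc_kernel_le_2[OF w \<zeta>] norm_disc_kernel_le_quotient[OF w \<zeta>]
      unfolding d_def by linarith
  qed
  then have A: "norm (disc_kernel w \<zeta>) ^ q \<le> 2 ^ q * min 1 (1 / 2 ^ k / d) ^ q"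
    unfolding power_mult_distrib[symmetric] by (intro power_mono) auto
  have "psi_at w \<le> \<psi> (2 * 2 ^ k)"
    using k w by (intro psi_mono) (auto simp: divide_simps)
  also have "\<dots> \<le> D * \<psi> (2 ^ k)" by (rule psi_doubling) simp
  finally have "psi_at w * norm (disc_kernel w \<zeta>) ^ q
      \<le> (D * \<psi> (2 ^ k)) * (2 ^ q * min 1 (1 / 2 ^ k / d) ^ q)"
    using A D_ge_1 psi_pos[of "2 ^ k"] by (intro mult_mono) auto
  also have "\<dots> = D * 2 ^ q * (\<psi> (2 ^ k) * min 1 (1 / 2 ^ k / d) ^ q)" by (simp only: mult_ac)
  also have "\<psi> (2 ^ k) * min 1 (1 / 2 ^ k / d) ^ q
      \<le> (\<Sum>k<Suc k. \<psi> (2 ^ k) * min 1 (1 / 2 ^ k / d) ^ q)"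
    using d psi_pos[THEN less_imp_le]
    by (intro member_le_sum[of k "{..<Suc k}" "\<lambda>k. \<psi> (2 ^ k) * min 1 (1 / 2 ^ k / d) ^ q"]) auto
  also have "\<dots> \<le> dyadic_const * \<psi> (1 / d)" by (rule damped_dyadic_sum_le[OF q d])
  finally show ?thesis using D_ge_1 by (simp add: d_def mult_left_mono mult.assoc)
qed

text \<open>
  An interpolation formula of Lagrange type. The point is that the exponent in the bound does not depend
  on \<open>F\<close>, and on the data only through \<open>Cb\<close>. The constant \<open>k\<close> is chosen so that the factor
  \<open>exp (- k * psi_at (z n))\<close> contained in \<open>G n\<close> cancels exactly the growth of \<open>b n\<close> and of the normalising
  denominators of \<open>P n\<close>.
\<close>

lemma finite_interpolation:
  fixes z :: "nat \<Rightarrow> complex" and b :: "nat \<Rightarrow> complex" and S L Cb :: real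
  assumes inj: "inj z" and z: "\<And>n. norm (z n) < 1" and q: "2 * D \<le> 2 ^ q"
    and S: "\<And>\<zeta> F. norm \<zeta> < 1 \<Longrightarrow> finite F \<Longrightarrow>
              (\<Sum>j\<in>F. norm (disc_kernel (z j) \<zeta>) ^ (q + 4)) \<le> S * psi_at \<zeta>"
    and L: "\<And>n F. finite F \<Longrightarrow> n \<notin> F \<Longrightarrow> (\<Sum>j\<in>F. near_log (z n) (z j)) \<le> L * psi_at (z n)"
    and Cb: "\<And>n. norm (b n) \<le> exp (Cb * psi_at (z n))"
  defines "M \<equiv> ratio_const (q + 3) * S"
  defines "k \<equiv> Cb + M + L"
  assumes k0: "0 \<le> k" and F: "finite F"
  shows "\<exists>f. f holomorphic_on ball 0 1 \<and> (\<forall>n\<in>F. f (z n) = b n) \<and>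
    (\<forall>\<zeta>. norm \<zeta> < 1 \<longrightarrow> norm (f \<zeta>) \<le> exp ((M + k * (D * 2 ^ q * dyadic_const) + S) * psi_at \<zeta>))"
proof -
  define e where "e j = tempered_factor (q + 3) (z j)" for j
  define A where "A n = disc_kernel (z n)" for n
  define P where "P n \<zeta> = (\<Prod>j\<in>F - {n}. e j \<zeta> / e j (z n))" for n \<zeta>
  define G where "G n \<zeta> = exp (of_real (k * psi_at (z n)) * (A n \<zeta> ^ q - 1))" for n \<zeta>
  define f where "f \<zeta> = (\<Sum>n\<in>F. b n * P n \<zeta> * A n \<zeta> ^ (q + 4) * G n \<zeta>)" for \<zeta>
  have ne: "e j (z n) \<noteq> 0" if "j \<noteq> n" for j n
    unfolding e_def using that inj z by (intro tempered_factor_nonzero) (auto simp: inj_eq)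
  have holA: "A n holomorphic_on ball 0 1" for n
    unfolding A_def by (rule disc_kernel_holomorphic[OF z])
  have hole: "e n holomorphic_on ball 0 1" for n
    unfolding e_def by (rule tempered_factor_holomorphic[OF z])
  have hol: "f holomorphic_on ball 0 1"
    unfolding f_def P_def G_def by (intro holomorphic_intros holA hole) (auto simp: ne)
  have interp: "f (z n) = b n" if n: "n \<in> F" for n
  proof -
    have "f (z n) = (\<Sum>m\<in>F. if m = n then b n else 0)"
      unfolding f_def
    proof (intro sum.cong refl)
      fix m assume m: "m \<in> F"
      show "b m * P m (z n) * A m (z n) ^ (q + 4) * G m (z n) = (if m = n then b n else 0)"
      proof (cases "m = n")
        case True
        have "P n (z n) = 1" unfolding P_def using ne by (intro prod.neutral) auto
        moreover have "A n (z n) = 1" unfolding A_def by (rule disc_kernel_self[OF z])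
        ultimately show ?thesis using True by (simp add: G_def)
      next
        case False
        have "P m (z n) = 0" unfolding P_def
          using F n False by (intro prod_zero bexI[of _ n]) (auto simp: e_def)
        then show ?thesis using False by simp
      qed
    qed
    then show ?thesis using F n by simp
  qed
  have bound: "norm (f \<zeta>) \<le> exp ((M + k * (D * 2 ^ q * dyadic_const) + S) * psi_at \<zeta>)"
    if \<zeta>: "norm \<zeta> < 1" for \<zeta>
  proof -
    define x where "x = psi_at \<zeta>"
    define E where "E = exp ((M + k * (D * 2 ^ q * dyadic_const)) * x)"
    have prod: "norm (P n \<zeta>) \<le> exp (M * x + (M + L) * psi_at (z n))" for n
    proof -
      define r where "r = ratio_const (q + 3)"
      have r0: "0 \<le> r" unfolding r_def using ratio_const_pos less_imp_le by blast
      have "norm (P n \<zeta>) = (\<Prod>j\<in>F - {n}. norm (e j \<zeta>) / norm (e j (z n)))"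
        unfolding P_def prod_norm[symmetric] norm_divide ..
      also have "\<dots> \<le> (\<Prod>j\<in>F - {n}. exp (r * (norm (A j \<zeta>) ^ (q + 4) + norm (A j (z n)) ^ (q + 4))
          + near_log (z n) (z j)))"
      proof (intro prod_mono conjI)
        fix j assume j: "j \<in> F - {n}"
        then have jn: "z j \<noteq> z n" using inj by (auto simp: inj_eq)
        have "norm (e j \<zeta>) \<le> exp (r * (norm (A j \<zeta>) ^ Suc (q + 3) + norm (A j (z n)) ^ Suc (q + 3))
          + near_log (z n) (z j)) * norm (e j (z n))"
          unfolding e_def A_def r_def by (rule tempered_factor_ratio_le[OF z \<zeta> z jn]) simp
        moreover have "norm (e j (z n)) > 0" using ne j by auto
        moreover have "Suc (q + 3) = q + 4" by simp
        ultimately show "norm (e j \<zeta>) / norm (e j (z n))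
            \<le> exp (r * (norm (A j \<zeta>) ^ (q + 4) + norm (A j (z n)) ^ (q + 4)) + near_log (z n) (z j))"
          by (simp only: pos_divide_le_eq)
      qed simp
      also have "\<dots> = exp (\<Sum>j\<in>F - {n}. r * (norm (A j \<zeta>) ^ (q + 4) + norm (A j (z n)) ^ (q + 4))
          + near_log (z n) (z j))"
        by (rule exp_sum[symmetric]) (use F in simp)
      also have "(\<Sum>j\<in>F - {n}. r * (norm (A j \<zeta>) ^ (q + 4) + norm (A j (z n)) ^ (q + 4)) + near_log (z n) (z j))
        = r * (\<Sum>j\<in>F - {n}. norm (A j \<zeta>) ^ (q + 4)) + r * (\<Sum>j\<in>F - {n}. norm (A j (z n)) ^ (q + 4))
          + (\<Sum>j\<in>F - {n}. near_log (z n) (z j))"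
        by (simp only: sum.distrib sum_distrib_left distrib_left)
      also have "\<dots> \<le> r * (S * x) + r * (S * psi_at (z n)) + L * psi_at (z n)"
        unfolding A_def x_def using F r0
        by (intro add_mono mult_left_mono S L z \<zeta>) auto
      also have "\<dots> = M * x + (M + L) * psi_at (z n)" by (simp add: M_def r_def algebra_simps)
      finally show ?thesis by simp
    qed
    have peak: "norm (G n \<zeta>) \<le> exp (k * (D * 2 ^ q * dyadic_const) * x - k * psi_at (z n))" for n
    proof -
      have "Re (A n \<zeta> ^ q) \<le> norm (A n \<zeta>) ^ q"
        using complex_Re_le_cmod[of "A n \<zeta> ^ q"] by (simp add: norm_power)
      then have "k * (psi_at (z n) * Re (A n \<zeta> ^ q)) \<le> k * (psi_at (z n) * norm (A n \<zeta>) ^ q)"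
        using k0 psi_at_pos[OF z, of n] by (intro mult_left_mono) auto
      also have "\<dots> \<le> k * (D * 2 ^ q * dyadic_const * x)"
        unfolding A_def x_def
        by (intro mult_left_mono psi_at_mult_kernel_power_le[OF z \<zeta> q] k0)
      finally show ?thesis by (simp add: G_def algebra_simps)
    qed
    have summand: "norm (b n * P n \<zeta> * A n \<zeta> ^ (q + 4) * G n \<zeta>) \<le> E * norm (A n \<zeta>) ^ (q + 4)" for n
    proof -
      have "norm (b n) * norm (P n \<zeta>) * norm (G n \<zeta>) \<le>
        exp (Cb * psi_at (z n)) * exp (M * x + (M + L) * psi_at (z n))
          * exp (k * (D * 2 ^ q * dyadic_const) * x - k * psi_at (z n))"
        by (intro mult_mono Cb prod peak) auto
      also have "\<dots> = E"
        unfolding E_def exp_add[symmetric] by (simp add: k_def algebra_simps)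
      finally have "norm (b n) * norm (P n \<zeta>) * norm (G n \<zeta>) * norm (A n \<zeta>) ^ (q + 4)
          \<le> E * norm (A n \<zeta>) ^ (q + 4)"
        by (intro mult_right_mono) auto
      then show ?thesis by (simp only: norm_mult norm_power mult_ac)
    qed
    have "norm (f \<zeta>) \<le> (\<Sum>n\<in>F. E * norm (A n \<zeta>) ^ (q + 4))"
      unfolding f_def by (rule order_trans[OF norm_sum]) (intro sum_mono summand)
    also have "\<dots> = E * (\<Sum>n\<in>F. norm (A n \<zeta>) ^ (q + 4))" by (simp add: sum_distrib_left)
    also have "\<dots> \<le> E * (S * x)"
      unfolding A_def x_def E_def by (intro mult_left_mono S \<zeta> F) auto
    also have "\<dots> \<le> E * exp (S * x)"
    proof (rule mult_left_mono)
      show "S * x \<le> exp (S * x)" using exp_ge_add_one_self[of "S * x"] by linarith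
    qed (simp add: E_def)
    also have "\<dots> = exp ((M + k * (D * 2 ^ q * dyadic_const) + S) * x)"
      unfolding E_def exp_add[symmetric] by (simp add: algebra_simps)
    finally show ?thesis by (simp only: x_def)
  qed
  show ?thesis using hol interp bound by blast
qed

text \<open>
  The common bound makes the approximants a normal family, and the value at \<open>z n\<close> of a
  subsequence is eventually equal to \<open>b n\<close>.
\<close>

lemma interpolation_from_finite:
  fixes z :: "nat \<Rightarrow> complex" and C :: real
  assumes z: "\<And>n. norm (z n) < 1" and C: "0 \<le> C"
    and fin: "\<And>N. \<exists>f. f holomorphic_on ball 0 1 \<and> (\<forall>n<N. f (z n) = b n) \<and>
        (\<forall>\<zeta>. norm \<zeta> < 1 \<longrightarrow> norm (f \<zeta>) \<le> exp (C * psi_at \<zeta>))"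
  shows "\<exists>f. f holomorphic_on ball 0 1 \<and> (\<forall>n. f (z n) = b n) \<and>
        (\<forall>\<zeta>. norm \<zeta> < 1 \<longrightarrow> norm (f \<zeta>) \<le> exp (C * psi_at \<zeta>))"
proof -
  obtain f where f: "\<And>N. f N holomorphic_on ball 0 1" "\<And>N n. n < N \<Longrightarrow> f N (z n) = b n"
      "\<And>N \<zeta>. norm \<zeta> < 1 \<Longrightarrow> norm (f N \<zeta>) \<le> exp (C * psi_at \<zeta>)"
    using fin by metis
  define H where "H = {h. h holomorphic_on ball 0 1 \<and>
      (\<forall>\<zeta>. norm \<zeta> < 1 \<longrightarrow> norm (h \<zeta>) \<le> exp (C * psi_at \<zeta>))}"
  have bdd: "\<exists>B. \<forall>h\<in>H. \<forall>\<zeta>\<in>Q. norm (h \<zeta>) \<le> B" if Q: "compact Q" "Q \<subseteq> ball 0 1" for Q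
  proof (cases "Q = {}")
    case False
    obtain w where w: "w \<in> Q" "\<And>\<zeta>. \<zeta> \<in> Q \<Longrightarrow> norm \<zeta> \<le> norm w"
      using continuous_attains_sup[OF Q(1) False, of norm] by (auto intro: continuous_intros)
    have "norm (h \<zeta>) \<le> exp (C * psi_at w)" if h: "h \<in> H" and \<zeta>: "\<zeta> \<in> Q" for h \<zeta>
    proof -
      have 1: "norm \<zeta> < 1" "norm w < 1" "norm \<zeta> \<le> norm w" using Q w \<zeta> by auto
      have "psi_at \<zeta> \<le> psi_at w" using 1 by (intro psi_mono) (auto intro!: divide_left_mono simp: divide_simps)
      then have "exp (C * psi_at \<zeta>) \<le> exp (C * psi_at w)" using C by (simp add: mult_left_mono)
      moreover have "norm (h \<zeta>) \<le> exp (C * psi_at \<zeta>)" using h 1 by (simp add: H_def)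
      ultimately show ?thesis by linarith
    qed
    then show ?thesis by blast
  qed simp
  obtain g r where g: "g holomorphic_on ball 0 1" and r: "strict_mono (r :: nat \<Rightarrow> nat)"
      and lim: "\<And>\<zeta>. \<zeta> \<in> ball 0 1 \<Longrightarrow> (\<lambda>n. f (r n) \<zeta>) \<longlonglongrightarrow> g \<zeta>"
  proof (rule Montel[of "ball 0 1" H f])
    show "range f \<subseteq> H" using f by (auto simp: H_def)
    show "\<And>h. h \<in> H \<Longrightarrow> h holomorphic_on ball 0 1" by (simp add: H_def)
  qed (use bdd in auto)
  have "g (z n) = b n" for n
  proof -
    have "(\<lambda>m. f (r m) (z n)) \<longlonglongrightarrow> g (z n)" using z lim by simp
    moreover have "\<forall>\<^sub>F m in sequentially. f (r m) (z n) = b n"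
      using eventually_gt_at_top[of n]
      by eventually_elim (use f(2) seq_suble[OF r] order_less_le_trans in blast)
    ultimately have "(\<lambda>m. b n) \<longlonglongrightarrow> g (z n)" by (rule Lim_transform_eventually)
    then show ?thesis using LIMSEQ_unique tendsto_const by blast
  qed
  moreover have "norm (g \<zeta>) \<le> exp (C * psi_at \<zeta>)" if "norm \<zeta> < 1" for \<zeta>
  proof (rule Lim_norm_ubound[OF trivial_limit_sequentially])
    show "(\<lambda>n. f (r n) \<zeta>) \<longlonglongrightarrow> g \<zeta>" using lim that by simp
    show "\<forall>\<^sub>F m in sequentially. norm (f (r m) \<zeta>) \<le> exp (C * psi_at \<zeta>)"
      using f(3)[OF that] by simp
  qed
  ultimately show ?thesis using g by blast
qed

lemma interpolation_sufficient:
  fixes z :: "nat \<Rightarrow> complex" and B L :: real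
  assumes inj: "inj z" and z: "\<And>n. norm (z n) < 1"
    and B: "\<And>n F. finite F \<Longrightarrow> F \<subseteq> {j. norm (z n - z j) < (1 - norm (z n)) / 2} \<Longrightarrow>
              real (card F) \<le> B * psi_at (z n)"
    and L: "\<And>n F. finite F \<Longrightarrow> n \<notin> F \<Longrightarrow> (\<Sum>j\<in>F. near_log (z n) (z j)) \<le> L * psi_at (z n)"
  shows "interpolation_property z \<psi>"
  unfolding interpolation_property_def
proof (intro allI impI)
  fix b :: "nat \<Rightarrow> complex"
  assume "\<exists>C>0. \<forall>n. eln (norm (b n)) \<le> ereal (C * psi_at (z n))"
  then obtain Cb where Cb: "Cb > 0" "\<And>n. norm (b n) \<le> exp (Cb * psi_at (z n))"
    by (auto simp: eln_le_iff)
  obtain q where q: "2 * D \<le> 2 ^ q"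
    using real_arch_pow[of 2 "2 * D"] by (auto intro: less_imp_le)
  obtain S where S: "S > 0" "\<And>\<zeta> F. norm \<zeta> < 1 \<Longrightarrow> finite F \<Longrightarrow>
              (\<Sum>j\<in>F. norm (disc_kernel (z j) \<zeta>) ^ (q + 4)) \<le> S * psi_at \<zeta>"
  proof -
    have "\<exists>C>0. \<forall>\<zeta> F. norm \<zeta> < 1 \<longrightarrow> finite F \<longrightarrow>
           (\<Sum>j\<in>F. norm (disc_kernel (z j) \<zeta>) ^ (q + 4)) \<le> C * psi_at \<zeta>"
      by (rule kernel_power_sum_le) (fact z q B)+
    then show ?thesis using that by blast
  qed
  have "0 \<le> L * psi_at (z 0)" using L[of "{}" 0] by simp
  then have L0: "0 \<le> L" using psi_at_pos[OF z[of 0]] by (simp add: zero_le_mult_iff)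
  define M where "M = ratio_const (q + 3) * S"
  define k where "k = Cb + M + L"
  define C where "C = M + k * (D * 2 ^ q * dyadic_const) + S"
  have M0: "0 \<le> M" unfolding M_def using S ratio_const_pos[of "q + 3"] by (intro mult_nonneg_nonneg) auto
  have k0: "0 \<le> k" using M0 L0 Cb by (simp add: k_def)
  have C0: "0 < C" unfolding C_def using M0 k0 S D_ge_1 dyadic_const_pos
    by (intro add_nonneg_pos add_nonneg_nonneg mult_nonneg_nonneg) auto
  have "\<exists>f. f holomorphic_on ball 0 1 \<and> (\<forall>n<N. f (z n) = b n) \<and>
        (\<forall>\<zeta>. norm \<zeta> < 1 \<longrightarrow> norm (f \<zeta>) \<le> exp (C * psi_at \<zeta>))" for N
  proof -
    have "\<exists>f. f holomorphic_on ball 0 1 \<and> (\<forall>n\<in>{..<N}. f (z n) = b n) \<and>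
        (\<forall>\<zeta>. norm \<zeta> < 1 \<longrightarrow> norm (f \<zeta>) \<le> exp (C * psi_at \<zeta>))"
      unfolding C_def k_def M_def
      by (rule finite_interpolation) (fact inj z q S(2) L Cb(2) k0[unfolded k_def M_def] finite_lessThan)+
    then show ?thesis unfolding Ball_def lessThan_iff .
  qed
  then obtain f where f: "f holomorphic_on ball 0 1" "\<And>n. f (z n) = b n"
        "\<And>\<zeta>. norm \<zeta> < 1 \<Longrightarrow> norm (f \<zeta>) \<le> exp (C * psi_at \<zeta>)"
    using interpolation_from_finite[of z C b] z C0 by force
  have an: "f analytic_on ball 0 1" using f(1) by (simp add: analytic_on_open)
  have "eln (max_modulus r f) \<le> ereal (C * \<psi> (1 / (1 - r)))" if r: "r \<in> {0<..<1}" for r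
  proof -
    have "norm (f \<zeta>) \<le> exp (C * \<psi> (1 / (1 - r)))" if "norm \<zeta> = r" for \<zeta>
      using f(3)[of \<zeta>] r that by simp
    then show ?thesis
      using max_modulus_le[of r f "exp (C * \<psi> (1 / (1 - r)))"] r by (simp add: eln_le_iff)
  qed
  then show "\<exists>f C'. f analytic_on ball 0 1 \<and> C' > 0 \<and> (\<forall>n. f (z n) = b n) \<and>
           (\<forall>r\<in>{0<..<1}. eln (max_modulus r f) \<le> ereal (C' * \<psi> (1 / (1 - r))))"
    using an C0 f(2) by blast
qed

end

section \<open>The counting conditions as bounds for finite sums\<close>

lemma ln_inverse_pseudohyperbolic_dist:
  assumes "norm w < 1" "norm z < 1" "w \<noteq> z"
  shows "ln (1 / pseudohyperbolic_dist w z) = ln (norm (1 - cnj w * z)) - ln (norm (w - z))"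
proof -
  have "1 / pseudohyperbolic_dist w z = norm (1 - cnj w * z) / norm (w - z)"
    by (simp only: pseudohyperbolic_dist_def norm_divide divide_divide_eq_right mult_1_left)
  moreover have "0 < norm (1 - cnj w * z)" by (rule denominator_pos[OF assms(1,2)])
  moreover have "0 < norm (w - z)" using assms(3) by simp
  ultimately show ?thesis by (simp only: ln_divide_pos)
qed

text \<open>
  With \<open>r = (1 - |w|) / 2\<close> the quantity \<open>|1 - cnj w * z|\<close> lies between \<open>2 * r\<close> and \<open>5 * r\<close>.
  The first bound is what makes condition (iii) count points.
\<close>

lemma
  assumes w: "norm w < 1" and z: "norm z < 1" and ne: "w \<noteq> z" and d: "norm (w - z) < (1 - norm w) / 2"
  shows ln_2_le_ln_inverse_pseudohyperbolic_dist: "ln 2 \<le> ln (1 / pseudohyperbolic_dist w z)"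
    and ln_ratio_le_ln_inverse_pseudohyperbolic_dist:
      "ln ((1 - norm w) / 2 / norm (w - z)) \<le> ln (1 / pseudohyperbolic_dist w z)"
    and ln_inverse_pseudohyperbolic_dist_le:
      "ln (1 / pseudohyperbolic_dist w z) \<le> ln ((1 - norm w) / 2 / norm (w - z)) + ln 5"
proof -
  define r where "r = (1 - norm w) / 2"
  have r: "0 < r" using w by (simp add: r_def)
  have d0: "0 < norm (w - z)" using ne by simp
  have dr: "norm (w - z) < r" using d by (simp add: r_def)
  have low: "2 * r \<le> norm (1 - cnj w * z)"
    using boundary_dist_le_denominator[OF w z] by (simp add: r_def)
  have up: "norm (1 - cnj w * z) \<le> r * 5"
    using denominator_le[OF w, of z] d unfolding r_def by linarith
  have 1: "ln 2 + ln r \<le> ln (norm (1 - cnj w * z))"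
  proof -
    have "ln (2 * r) \<le> ln (norm (1 - cnj w * z))" using low r by (intro ln_mono) auto
    then show ?thesis using r by (simp add: ln_mult)
  qed
  have 2: "ln (norm (1 - cnj w * z)) \<le> ln r + ln 5"
  proof -
    have "0 < norm (1 - cnj w * z)" by (rule denominator_pos[OF w z])
    then have "ln (norm (1 - cnj w * z)) \<le> ln (r * 5)" using up by (intro ln_mono)
    then show ?thesis using r by (simp add: ln_mult)
  qed
  have 3: "ln (norm (w - z)) < ln r" using ln_less_cancel_iff[OF d0 r] dr by (rule iffD2)
  have 4: "ln (r / norm (w - z)) = ln r - ln (norm (w - z))" using r d0 by (simp add: ln_div)
  have 5: "0 \<le> ln (2::real)" by simp
  show "ln 2 \<le> ln (1 / pseudohyperbolic_dist w z)"
    "ln ((1 - norm w) / 2 / norm (w - z)) \<le> ln (1 / pseudohyperbolic_dist w z)"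
    "ln (1 / pseudohyperbolic_dist w z) \<le> ln ((1 - norm w) / 2 / norm (w - z)) + ln 5"
    unfolding ln_inverse_pseudohyperbolic_dist[OF w z ne] r_def[symmetric] 4
    using 1 2 3 5 by linarith+
qed

text \<open>
  Conditions (iii) and (ii) expressed by finite partial sums of real numbers. The index \<open>n\<close> is excluded in both,
  and the second one uses closed discs, as the integral does; points on the boundary contribute 0.
\<close>

definition separation_sums_bounded :: "(nat \<Rightarrow> complex) \<Rightarrow> (real \<Rightarrow> real) \<Rightarrow> bool" where
  "separation_sums_bounded z \<psi> \<longleftrightarrow>
     (\<exists>C>0. \<forall>n F. finite F \<longrightarrow> F \<subseteq> {j. j \<noteq> n \<and> norm (z n - z j) < (1 - norm (z n)) / 2} \<longrightarrow>
        (\<Sum>j\<in>F. ln (1 / pseudohyperbolic_dist (z n) (z j))) \<le> C * \<psi> (1 / (1 - norm (z n))))"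

definition count_sums_bounded :: "(nat \<Rightarrow> complex) \<Rightarrow> (real \<Rightarrow> real) \<Rightarrow> bool" where
  "count_sums_bounded z \<psi> \<longleftrightarrow>
     (\<exists>C>0. \<forall>n F. finite F \<longrightarrow> F \<subseteq> {j. j \<noteq> n \<and> norm (z n - z j) \<le> (1 - norm (z n)) / 2} \<longrightarrow>
        (\<Sum>j\<in>F. ln ((1 - norm (z n)) / 2 / norm (z n - z j))) \<le> C * \<psi> (1 / (1 - norm (z n))))"

lemma count_near_minus_1:
  assumes t: "0 \<le> t"
  shows "count_near z (z n) t - 1 = (\<Sum>k. if k \<noteq> n \<and> norm (z k - z n) \<le> t then 1 else 0)"
proof -
  define B where "B = {k. k \<noteq> n \<and> norm (z k - z n) \<le> t}"
  have "{k. norm (z k - z n) \<le> t} = {n} \<union> B" using t by (auto simp: B_def)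
  then have "count_near z (z n) t = emeasure (count_space UNIV) ({n} \<union> B)"
    by (simp only: count_near_def)
  also have "\<dots> = emeasure (count_space UNIV) {n} + emeasure (count_space UNIV) B"
    by (rule plus_emeasure[symmetric]) (auto simp: B_def)
  also have "emeasure (count_space UNIV) {n} = 1" by simp
  finally have "count_near z (z n) t - 1 = emeasure (count_space UNIV) B" by simp
  also have "\<dots> = (\<integral>\<^sup>+k. indicator B k \<partial>count_space UNIV)" by simp
  also have "\<dots> = (\<Sum>k. indicator B k)" by (rule nn_integral_count_space_nat)
  also have "(\<lambda>k. indicator B k :: ennreal) = (\<lambda>k. if k \<noteq> n \<and> norm (z k - z n) \<le> t then 1 else 0)"
    by (auto simp: B_def fun_eq_iff indicator_def)
  finally show ?thesis .
qed

text \<open>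
  Each point at distance \<open>d\<close> from the centre contributes the integral of \<open>1 / t\<close> from \<open>d\<close> to \<open>r\<close>, and in
  \<open>count_near - 1\<close> the centre itself is removed. The identity also holds when both sides are infinite, because it
  exchanges an integral with a series of nonnegative functions.
\<close>

lemma integrated_count_eq:
  assumes inj: "inj z" and r: "0 < r"
  shows "integrated_count z (z n) r =
    (\<Sum>k. if k \<noteq> n \<and> norm (z n - z k) \<le> r then ennreal (ln (r / norm (z n - z k))) else 0)"
proof -
  define d where "d k = norm (z k - z n)" for k
  have d0: "0 < d k" if "k \<noteq> n" for k using that inj by (simp add: d_def inj_eq)
  define g where "g k t = (if k \<noteq> n \<and> d k \<le> r then ennreal (1 / t) * indicator {d k..r} t else 0)" for k t
  have point: "(count_near z (z n) t - 1) / ennreal t * indicator {0..r} t = (\<Sum>k. g k t)" for t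
  proof (cases "t \<in> {0<..r}")
    case True
    then have t: "0 < t" "t \<le> r" by auto
    have "(count_near z (z n) t - 1) / ennreal t * indicator {0..r} t
        = (\<Sum>k. if k \<noteq> n \<and> d k \<le> t then 1 else 0) * ennreal (1 / t)"
      using t count_near_minus_1[of t z n]
      by (simp add: d_def divide_ennreal_def inverse_ennreal inverse_eq_divide)
    also have "\<dots> = (\<Sum>k. (if k \<noteq> n \<and> d k \<le> t then 1 else 0) * ennreal (1 / t))"
      by (rule ennreal_suminf_multc[symmetric])
    also have "(\<lambda>k. (if k \<noteq> n \<and> d k \<le> t then 1 else 0) * ennreal (1 / t)) = (\<lambda>k. g k t)"
      using t by (auto simp: g_def fun_eq_iff indicator_def)
    finally show ?thesis .
  next
    case False
    have "g k t = 0" for k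
    proof (cases "k = n")
      case False
      then show ?thesis using \<open>t \<notin> {0<..r}\<close> d0[of k] by (auto simp: g_def indicator_def)
    qed (simp add: g_def)
    moreover have "(count_near z (z n) t - 1) / ennreal t * indicator {0..r} t = 0"
    proof (cases "t = 0")
      case True
      have "(\<lambda>k. if k \<noteq> n \<and> norm (z k - z n) \<le> 0 then 1 else (0::ennreal)) = (\<lambda>k. 0)"
        using d0 by (auto simp: fun_eq_iff d_def)
      then have "count_near z (z n) 0 - 1 = 0"
        using count_near_minus_1[of 0 z n] by simp
      then show ?thesis using True by simp
    qed (use False in \<open>auto simp: indicator_def\<close>)
    ultimately show ?thesis by simp
  qed
  have meas: "g k \<in> borel_measurable lborel" for k
    unfolding g_def by measurable
  have "integrated_count z (z n) r = (\<integral>\<^sup>+t. (\<Sum>k. g k t) \<partial>lborel)"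
    unfolding integrated_count_def by (simp only: point)
  also have "\<dots> = (\<Sum>k. \<integral>\<^sup>+t. g k t \<partial>lborel)" by (rule nn_integral_suminf[OF meas])
  also have "(\<lambda>k. \<integral>\<^sup>+t. g k t \<partial>lborel)
      = (\<lambda>k. if k \<noteq> n \<and> norm (z n - z k) \<le> r then ennreal (ln (r / norm (z n - z k))) else 0)"
  proof
    fix k
    show "(\<integral>\<^sup>+t. g k t \<partial>lborel)
      = (if k \<noteq> n \<and> norm (z n - z k) \<le> r then ennreal (ln (r / norm (z n - z k))) else 0)"
    proof (cases "k \<noteq> n \<and> d k \<le> r")
      case True
      then have k: "0 < d k" "d k \<le> r" using d0 by auto
      have "(\<integral>\<^sup>+t. ennreal (1 / t) * indicator {d k..r} t \<partial>lborel) = ennreal (ln r - ln (d k))"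
      proof (rule nn_integral_FTC_Icc)
        show "(ln has_real_derivative 1 / t) (at t)" if "t \<in> {d k..r}" for t
          using that k by (intro DERIV_ln_divide) simp
        show "0 \<le> 1 / t" if "t \<in> {d k..r}" for t using that k by simp
        show "(\<lambda>t::real. 1 / t) \<in> borel_measurable borel" by measurable
      qed (rule k(2))
      then show ?thesis using True k r by (simp add: g_def d_def norm_minus_commute ln_div)
    next
      case False
      then have "g k = (\<lambda>t. 0)" unfolding g_def by (intro ext if_not_P)
      then show ?thesis using False by (auto simp: d_def norm_minus_commute)
    qed
  qed
  finally show ?thesis .
qed

context doubling_growth
begin

lemma log_separation_bounded_iff_sums:
  assumes inj: "inj z" and z: "\<And>n. norm (z n) < 1"
  shows "log_separation_bounded z \<psi> \<longleftrightarrow> separation_sums_bounded z \<psi>"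
proof -
  have pointwise: "(\<Sum>\<^sub>\<infinity>j\<in>{j. 0 < norm (z n - z j) \<and> norm (z n - z j) < 1/2 * (1 - norm (z n))}.
           ennreal (ln (1 / pseudohyperbolic_dist (z n) (z j)))) \<le> ennreal (C * psi_at (z n)) \<longleftrightarrow>
      (\<forall>F. finite F \<longrightarrow> F \<subseteq> {j. j \<noteq> n \<and> norm (z n - z j) < (1 - norm (z n)) / 2} \<longrightarrow>
        (\<Sum>j\<in>F. ln (1 / pseudohyperbolic_dist (z n) (z j))) \<le> C * psi_at (z n))"
    if C: "C > 0" for C n
  proof -
    define A where "A = {j. j \<noteq> n \<and> norm (z n - z j) < (1 - norm (z n)) / 2}"
    have A: "{j. 0 < norm (z n - z j) \<and> norm (z n - z j) < 1/2 * (1 - norm (z n))} = A"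
      using inj by (auto simp: A_def inj_eq)
    have sum: "(\<Sum>j\<in>F. ennreal (ln (1 / pseudohyperbolic_dist (z n) (z j))))
        = ennreal (\<Sum>j\<in>F. ln (1 / pseudohyperbolic_dist (z n) (z j)))" if "F \<subseteq> A" for F
    proof (rule sum_ennreal)
      fix j assume "j \<in> F"
      then have "ln 2 \<le> ln (1 / pseudohyperbolic_dist (z n) (z j))"
        using that inj z by (intro ln_2_le_ln_inverse_pseudohyperbolic_dist) (auto simp: A_def inj_eq)
      moreover have "0 \<le> ln (2::real)" by simp
      ultimately show "0 \<le> ln (1 / pseudohyperbolic_dist (z n) (z j))" by linarith
    qed
    have "0 \<le> C * psi_at (z n)" using C psi_at_pos[OF z, of n] by simp
    then show ?thesis
      unfolding A A_def[symmetric]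
      by (subst nonneg_infsum_complete) (auto simp: SUP_le_iff sum ennreal_le_iff)
  qed
  then show ?thesis
    unfolding log_separation_bounded_def separation_sums_bounded_def by (simp only: cong: conj_cong)
qed

lemma integrated_count_bounded_iff_sums:
  assumes inj: "inj z" and z: "\<And>n. norm (z n) < 1"
  shows "integrated_count_bounded z \<psi> \<longleftrightarrow> count_sums_bounded z \<psi>"
proof -
  have pointwise: "integrated_count z (z n) ((1 - norm (z n)) / 2) \<le> ennreal (C * psi_at (z n)) \<longleftrightarrow>
      (\<forall>F. finite F \<longrightarrow> F \<subseteq> {j. j \<noteq> n \<and> norm (z n - z j) \<le> (1 - norm (z n)) / 2} \<longrightarrow>
        (\<Sum>j\<in>F. ln ((1 - norm (z n)) / 2 / norm (z n - z j))) \<le> C * psi_at (z n))"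
    if C: "C > 0" for C n
  proof -
    define r where "r = (1 - norm (z n)) / 2"
    have r: "0 < r" using z[of n] by (simp add: r_def)
    define A where "A = {j. j \<noteq> n \<and> norm (z n - z j) \<le> r}"
    define h where "h k = (if k \<in> A then ennreal (ln (r / norm (z n - z k))) else 0)" for k
    have ic: "integrated_count z (z n) r = (\<Sum>k. h k)"
      unfolding integrated_count_eq[OF inj r] h_def A_def by simp
    have sum: "(\<Sum>j\<in>F. h j) = ennreal (\<Sum>j\<in>F. ln (r / norm (z n - z j)))" if F: "F \<subseteq> A" for F
    proof -
      have "(\<Sum>j\<in>F. h j) = (\<Sum>j\<in>F. ennreal (ln (r / norm (z n - z j))))"
        using F by (intro sum.cong) (auto simp: h_def)
      also have "\<dots> = ennreal (\<Sum>j\<in>F. ln (r / norm (z n - z j)))"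
      proof (rule sum_ennreal)
        fix j assume "j \<in> F"
        then have "0 < norm (z n - z j)" "norm (z n - z j) \<le> r"
          using F inj by (auto simp: A_def inj_eq)
        then show "0 \<le> ln (r / norm (z n - z j))" by (intro ln_ge_zero) simp
      qed
      finally show ?thesis .
    qed
    have C0: "0 \<le> C * psi_at (z n)" using C psi_at_pos[OF z, of n] by simp
    have "(\<Sum>k. h k) \<le> ennreal (C * psi_at (z n)) \<longleftrightarrow>
        (\<forall>F. finite F \<longrightarrow> F \<subseteq> A \<longrightarrow> (\<Sum>j\<in>F. ln (r / norm (z n - z j))) \<le> C * psi_at (z n))"
    proof (intro iffI allI impI)
      fix F assume le: "(\<Sum>k. h k) \<le> ennreal (C * psi_at (z n))" and F: "finite F" "F \<subseteq> A"
      have "(\<Sum>j\<in>F. h j) \<le> (\<Sum>k. h k)" using F by (intro sum_le_suminf) auto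
      then have "ennreal (\<Sum>j\<in>F. ln (r / norm (z n - z j))) \<le> ennreal (C * psi_at (z n))"
        using le sum[OF F(2)] by (metis order_trans)
      then show "(\<Sum>j\<in>F. ln (r / norm (z n - z j))) \<le> C * psi_at (z n)"
        using C0 by (simp add: ennreal_le_iff)
    next
      assume fin: "\<forall>F. finite F \<longrightarrow> F \<subseteq> A \<longrightarrow> (\<Sum>j\<in>F. ln (r / norm (z n - z j))) \<le> C * psi_at (z n)"
      show "(\<Sum>k. h k) \<le> ennreal (C * psi_at (z n))"
      proof (rule suminf_le_const)
        fix N
        have "(\<Sum>k<N. h k) = (\<Sum>k\<in>{..<N} \<inter> A. h k)"
          by (rule sum.mono_neutral_right) (auto simp: h_def)
        also have "\<dots> = ennreal (\<Sum>j\<in>{..<N} \<inter> A. ln (r / norm (z n - z j)))" by (rule sum) simp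
        also have "\<dots> \<le> ennreal (C * psi_at (z n))" using fin by (intro ennreal_leI) simp
        finally show "(\<Sum>k<N. h k) \<le> ennreal (C * psi_at (z n))" .
      qed simp
    qed
    then show ?thesis unfolding ic[symmetric] A_def r_def .
  qed
  then show ?thesis
    unfolding integrated_count_bounded_def count_sums_bounded_def by (simp only: cong: conj_cong)
qed

lemma count_sums_if_separation_sums:
  assumes inj: "inj z" and z: "\<And>n. norm (z n) < 1" and sep: "separation_sums_bounded z \<psi>"
  shows "count_sums_bounded z \<psi>"
proof -
  obtain C where C: "C > 0" and sums: "\<And>n F. finite F \<Longrightarrow>
      F \<subseteq> {j. j \<noteq> n \<and> norm (z n - z j) < (1 - norm (z n)) / 2} \<Longrightarrow>
      (\<Sum>j\<in>F. ln (1 / pseudohyperbolic_dist (z n) (z j))) \<le> C * psi_at (z n)"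
    using sep unfolding separation_sums_bounded_def by blast
  have "(\<Sum>j\<in>F. ln ((1 - norm (z n)) / 2 / norm (z n - z j))) \<le> C * psi_at (z n)"
    if F: "finite F" "F \<subseteq> {j. j \<noteq> n \<and> norm (z n - z j) \<le> (1 - norm (z n)) / 2}" for n F
  proof -
    define r where "r = (1 - norm (z n)) / 2"
    have r: "0 < r" using z[of n] by (simp add: r_def)
    \<comment> \<open>The difference between the closed and the open disc is harmless: the logarithm vanishes on the boundary.\<close>
    define F' where "F' = {j\<in>F. norm (z n - z j) < r}"
    have "(\<Sum>j\<in>F. ln (r / norm (z n - z j))) = (\<Sum>j\<in>F'. ln (r / norm (z n - z j)))"
    proof (rule sum.mono_neutral_right)
      show "\<forall>j\<in>F - F'. ln (r / norm (z n - z j)) = 0"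
      proof
        fix j assume "j \<in> F - F'"
        then have "norm (z n - z j) = r" using F by (auto simp: F'_def r_def)
        then show "ln (r / norm (z n - z j)) = 0" using r by simp
      qed
    qed (use F in \<open>auto simp: F'_def\<close>)
    also have "\<dots> \<le> (\<Sum>j\<in>F'. ln (1 / pseudohyperbolic_dist (z n) (z j)))"
    proof (rule sum_mono)
      fix j assume "j \<in> F'"
      then have "z n \<noteq> z j" "norm (z n - z j) < (1 - norm (z n)) / 2"
        using F inj by (auto simp: F'_def r_def inj_eq)
      then show "ln (r / norm (z n - z j)) \<le> ln (1 / pseudohyperbolic_dist (z n) (z j))"
        unfolding r_def by (intro ln_ratio_le_ln_inverse_pseudohyperbolic_dist z)
    qed
    also have "\<dots> \<le> C * psi_at (z n)"
      using F by (intro sums) (auto simp: F'_def r_def)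
    finally show ?thesis by (simp only: r_def)
  qed
  then show ?thesis
    unfolding count_sums_bounded_def using C by (intro exI[of _ C] conjI allI impI) simp_all
qed

text \<open>
  Each point of the disc other than the centre contributes at least \<open>ln 2\<close> to the sum.
\<close>

lemma card_near_le_if_separation_sums:
  assumes inj: "inj z" and z: "\<And>n. norm (z n) < 1" and sep: "separation_sums_bounded z \<psi>"
  shows "\<exists>B. \<forall>n F. finite F \<longrightarrow> F \<subseteq> {j. norm (z n - z j) < (1 - norm (z n)) / 2} \<longrightarrow>
    real (card F) \<le> B * psi_at (z n)"
proof -
  obtain C where C: "C > 0" and sums: "\<And>n F. finite F \<Longrightarrow>
      F \<subseteq> {j. j \<noteq> n \<and> norm (z n - z j) < (1 - norm (z n)) / 2} \<Longrightarrow>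
      (\<Sum>j\<in>F. ln (1 / pseudohyperbolic_dist (z n) (z j))) \<le> C * psi_at (z n)"
    using sep unfolding separation_sums_bounded_def by blast
  have "real (card F) \<le> (1 / \<psi> 1 + C / ln 2) * psi_at (z n)"
    if F: "finite F" "F \<subseteq> {j. norm (z n - z j) < (1 - norm (z n)) / 2}" for n F
  proof -
    have "real (card (F - {n})) * ln 2 \<le> (\<Sum>j\<in>F - {n}. ln (1 / pseudohyperbolic_dist (z n) (z j)))"
      using F inj z
      by (intro sum_bounded_below ln_2_le_ln_inverse_pseudohyperbolic_dist) (auto simp: inj_eq)
    also have "\<dots> \<le> C * psi_at (z n)" using F by (intro sums) auto
    finally have "real (card (F - {n})) \<le> C / ln 2 * psi_at (z n)" by (simp add: field_simps)
    moreover have "card F \<le> Suc (card (F - {n}))" using F(1) by (auto simp: card_Diff_singleton_if)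
    then have "real (card F) \<le> 1 + real (card (F - {n}))" by linarith
    moreover have "1 \<le> 1 / \<psi> 1 * psi_at (z n)"
      using psi_mono[of 1 "1 / (1 - norm (z n))"] psi_pos[of 1] z[of n] by (simp add: divide_simps)
    ultimately show ?thesis by (simp add: distrib_right)
  qed
  then show ?thesis by blast
qed

text \<open>
  Points close to the boundary of the disc of radius \<open>r\<close> around \<open>z n\<close> hardly contribute to the sum at \<open>z n\<close>. They are
  counted instead by the sums at other points: cut the disc by a square grid of mesh \<open>r / 8\<close> into
  at most 289 = 17 * 17 cells. If \<open>z i\<close> is in a cell, the other points of the cell lie well inside
  the disc belonging to \<open>z i\<close> and contribute at least \<open>ln 2\<close> each, and doubling compares \<open>psi_at (z i)\<close>
  with \<open>psi_at (z n)\<close>.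
\<close>

lemma card_near_le_if_count_sums:
  assumes inj: "inj z" and z: "\<And>n. norm (z n) < 1" and cnt: "count_sums_bounded z \<psi>"
  shows "\<exists>B. \<forall>n F. finite F \<longrightarrow> F \<subseteq> {j. norm (z n - z j) < (1 - norm (z n)) / 2} \<longrightarrow>
    real (card F) \<le> B * psi_at (z n)"
proof -
  obtain C where C: "C > 0" and sums: "\<And>n F. finite F \<Longrightarrow>
      F \<subseteq> {j. j \<noteq> n \<and> norm (z n - z j) \<le> (1 - norm (z n)) / 2} \<Longrightarrow>
      (\<Sum>j\<in>F. ln ((1 - norm (z n)) / 2 / norm (z n - z j))) \<le> C * psi_at (z n)"
    using cnt unfolding count_sums_bounded_def by blast
  define b where "b = 1 / \<psi> 1 + C * D / ln 2"
  have "real (card F) \<le> (289 * b) * psi_at (z n)"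
    if F: "finite F" "F \<subseteq> {j. norm (z n - z j) < (1 - norm (z n)) / 2}" for n F
  proof -
    define r where "r = (1 - norm (z n)) / 2"
    have r: "0 < r" using z[of n] by (simp add: r_def)
    define g where "g j = (\<lfloor>8 * Re (z j - z n) / r\<rfloor>, \<lfloor>8 * Im (z j - z n) / r\<rfloor>)" for j
    have dist: "norm (z n - z j) < r" if "j \<in> F" for j using F that by (auto simp: r_def)
    have cell: "real (card {j\<in>F. g j = g i}) \<le> b * psi_at (z n)" if i: "i \<in> F" for i
    proof -
      define Q where "Q = {j\<in>F. g j = g i} - {i}"
      have ri: "r \<le> 1 - norm (z i)"
      proof -
        have "2 * r = 1 - norm (z n)" by (simp add: r_def)
        then show ?thesis using dist[OF i] norm_triangle_ineq3[of "z n" "z i"] by linarith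
      qed
      have close: "norm (z i - z j) \<le> r / 4" if j: "j \<in> Q" for j
      proof -
        have "\<lfloor>8 * Re (z j - z n) / r\<rfloor> = \<lfloor>8 * Re (z i - z n) / r\<rfloor>"
             "\<lfloor>8 * Im (z j - z n) / r\<rfloor> = \<lfloor>8 * Im (z i - z n) / r\<rfloor>"
          using j by (auto simp: Q_def g_def)
        then have "\<bar>8 * Re (z j - z n) / r - 8 * Re (z i - z n) / r\<bar> < 1"
          "\<bar>8 * Im (z j - z n) / r - 8 * Im (z i - z n) / r\<bar> < 1"
          by linarith+
        moreover have "8 * Re (z j - z n) / r - 8 * Re (z i - z n) / r = 8 / r * Re (z j - z i)"
          "8 * Im (z j - z n) / r - 8 * Im (z i - z n) / r = 8 / r * Im (z j - z i)"
          by (simp_all add: diff_divide_distrib[symmetric] algebra_simps)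
        moreover have "\<bar>x\<bar> < r / 8" if "\<bar>8 / r * x\<bar> < 1" for x
          using that r by (simp add: abs_mult field_simps)
        ultimately have "\<bar>Re (z j - z i)\<bar> < r / 8" "\<bar>Im (z j - z i)\<bar> < r / 8"
          by (simp_all only:)
        moreover have "norm (z j - z i) \<le> \<bar>Re (z j - z i)\<bar> + \<bar>Im (z j - z i)\<bar>" by (rule cmod_le)
        ultimately show ?thesis by (simp add: norm_minus_commute)
      qed
      have "real (card Q) * ln 2 \<le> (\<Sum>j\<in>Q. ln ((1 - norm (z i)) / 2 / norm (z i - z j)))"
      proof (rule sum_bounded_below)
        fix j assume j: "j \<in> Q"
        have pos: "0 < norm (z i - z j)" using j inj by (auto simp: Q_def inj_eq)
        have "2 * norm (z i - z j) \<le> (1 - norm (z i)) / 2" using close[OF j] ri by (simp add: field_simps)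
        then have "2 \<le> (1 - norm (z i)) / 2 / norm (z i - z j)" using pos by (simp only: pos_le_divide_eq)
        then show "ln 2 \<le> ln ((1 - norm (z i)) / 2 / norm (z i - z j))" by (intro ln_mono) auto
      qed
      also have "\<dots> \<le> C * psi_at (z i)"
      proof (rule sums)
        show "finite Q" using F by (simp add: Q_def)
        show "Q \<subseteq> {j. j \<noteq> i \<and> norm (z i - z j) \<le> (1 - norm (z i)) / 2}"
          using close ri r by (force simp: Q_def)
      qed
      also have "\<dots> \<le> C * (D * psi_at (z n))"
      proof -
        have "1 / (1 - norm (z i)) \<le> 1 / r" using ri r by (intro divide_left_mono) auto
        also have "1 / r = 2 * (1 / (1 - norm (z n)))" by (simp add: r_def)
        finally have "psi_at (z i) \<le> \<psi> (2 * (1 / (1 - norm (z n))))"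
          using z[of i] by (intro psi_mono) (auto simp: divide_simps)
        also have "\<dots> \<le> D * psi_at (z n)" using z[of n] by (intro psi_doubling) (simp add: divide_simps)
        finally show ?thesis using C by simp
      qed
      finally have "real (card Q) \<le> C * D / ln 2 * psi_at (z n)" by (simp add: field_simps)
      moreover have "card {j\<in>F. g j = g i} \<le> Suc (card Q)"
        using F(1) by (auto simp: Q_def card_Diff_singleton_if)
      then have "real (card {j\<in>F. g j = g i}) \<le> 1 + real (card Q)" by linarith
      moreover have "1 \<le> 1 / \<psi> 1 * psi_at (z n)"
        using psi_mono[of 1 "1 / (1 - norm (z n))"] psi_pos[of 1] z[of n] by (simp add: divide_simps)
      ultimately show ?thesis by (simp add: distrib_right b_def)
    qed
    have box: "g ` F \<subseteq> {-8..8} \<times> {-8..8}"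
    proof -
      have "\<lfloor>8 * x / r\<rfloor> \<in> {-8..8}" if "\<bar>x\<bar> < r" for x
      proof -
        have "-8 \<le> 8 * x / r" "8 * x / r \<le> 8" using that r by (auto simp: field_simps)
        then show ?thesis by (auto simp: le_floor_iff floor_le_iff)
      qed
      moreover have "\<bar>Re (z j - z n)\<bar> < r" "\<bar>Im (z j - z n)\<bar> < r" if "j \<in> F" for j
        using dist[OF that] abs_Re_le_cmod[of "z j - z n"] abs_Im_le_cmod[of "z j - z n"]
          norm_minus_commute[of "z j" "z n"] by linarith+
      ultimately show ?thesis unfolding g_def by blast
    qed
    have cardg: "card (g ` F) \<le> 289"
      using card_mono[OF _ box] by simp
    have b0: "0 \<le> b * psi_at (z n)"
      using C D_ge_1 psi_pos[of 1] psi_at_pos[OF z, of n] unfolding b_def by (intro mult_nonneg_nonneg) auto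
    have "real (card F) = (\<Sum>j\<in>F. 1)" by simp
    also have "\<dots> = (\<Sum>c\<in>g ` F. \<Sum>j\<in>{j\<in>F. g j = c}. 1)" by (rule sum.image_gen[OF F(1)])
    also have "\<dots> = (\<Sum>c\<in>g ` F. real (card {j\<in>F. g j = c}))" by simp
    also have "\<dots> \<le> real (card (g ` F)) * (b * psi_at (z n))"
      using cell by (intro sum_bounded_above) auto
    also have "\<dots> \<le> 289 * (b * psi_at (z n))" using cardg b0 by (intro mult_right_mono) auto
    finally show ?thesis by (simp add: mult.assoc)
  qed
  then show ?thesis by blast
qed

lemma separation_sums_if_count_sums:
  assumes inj: "inj z" and z: "\<And>n. norm (z n) < 1" and cnt: "count_sums_bounded z \<psi>"
  shows "separation_sums_bounded z \<psi>"
proof -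
  obtain C where C: "C > 0" and sums: "\<And>n F. finite F \<Longrightarrow>
      F \<subseteq> {j. j \<noteq> n \<and> norm (z n - z j) \<le> (1 - norm (z n)) / 2} \<Longrightarrow>
      (\<Sum>j\<in>F. ln ((1 - norm (z n)) / 2 / norm (z n - z j))) \<le> C * psi_at (z n)"
    using cnt unfolding count_sums_bounded_def by blast
  obtain B where B: "\<And>n F. finite F \<Longrightarrow> F \<subseteq> {j. norm (z n - z j) < (1 - norm (z n)) / 2} \<Longrightarrow>
    real (card F) \<le> B * psi_at (z n)"
    using card_near_le_if_count_sums[OF inj z cnt] by blast
  have "0 \<le> B * psi_at (z 0)" using B[of "{}" 0] by simp
  then have B0: "0 \<le> B" using psi_at_pos[OF z[of 0]] by (simp add: zero_le_mult_iff)
  have "(\<Sum>j\<in>F. ln (1 / pseudohyperbolic_dist (z n) (z j))) \<le> (C + B * ln 5) * psi_at (z n)"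
    if F: "finite F" "F \<subseteq> {j. j \<noteq> n \<and> norm (z n - z j) < (1 - norm (z n)) / 2}" for n F
  proof -
    have "(\<Sum>j\<in>F. ln (1 / pseudohyperbolic_dist (z n) (z j)))
        \<le> (\<Sum>j\<in>F. ln ((1 - norm (z n)) / 2 / norm (z n - z j)) + ln 5)"
      using F inj z by (intro sum_mono ln_inverse_pseudohyperbolic_dist_le) (auto simp: inj_eq)
    also have "\<dots> = (\<Sum>j\<in>F. ln ((1 - norm (z n)) / 2 / norm (z n - z j))) + real (card F) * ln 5"
      by (simp add: sum.distrib)
    also have "\<dots> \<le> C * psi_at (z n) + B * psi_at (z n) * ln 5"
      using F by (intro add_mono mult_right_mono sums B) auto
    finally show ?thesis by (simp add: algebra_simps)
  qed
  moreover have "0 < C + B * ln 5" using C B0 by (intro add_pos_nonneg) auto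
  ultimately show ?thesis unfolding separation_sums_bounded_def by blast
qed

end

section \<open>Jensen's inequality and the necessity of the counting condition\<close>

text \<open>
  Jensen's inequality for a finite set of zeros. Dividing \<open>f\<close> by the Blaschke factor of one zero
  of the disc leaves its modulus on the circle unchanged, multiplies its modulus at the centre by
  \<open>r / |w - c|\<close> and removes that zero; when none is left, the maximum modulus principle applies.
\<close>

lemma norm_centre_mult_prod_zeros_le:
  assumes "finite W" "0 < r" "r < R"
    and "f holomorphic_on ball c R" "W \<subseteq> ball c r - {c}"
    and "\<And>w. w \<in> W \<Longrightarrow> f w = 0"
    and "\<And>z. norm (z - c) = r \<Longrightarrow> norm (f z) \<le> M"
  shows "norm (f c) * (\<Prod>w\<in>W. r / norm (w - c)) \<le> M"
  using assms
proof (induction W arbitrary: f rule: finite_induct)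
  case empty
  have "norm (f c) \<le> M"
  proof (rule maximum_modulus_frontier[where S = "cball c r" and f = f and \<xi> = c])
    show "f holomorphic_on interior (cball c r)"
      unfolding interior_cball using empty.prems(2)
      by (intro holomorphic_on_subset[OF empty.prems(3)] subset_ball) simp
    have "cball c r \<subseteq> ball c R" using empty.prems(2) by (simp add: cball_subset_ball_iff)
    then show "continuous_on (closure (cball c r)) f"
      unfolding closure_closed[OF closed_cball]
      by (rule continuous_on_subset[OF holomorphic_on_imp_continuous_on[OF empty.prems(3)]])
    show "norm (f z) \<le> M" if "z \<in> frontier (cball c r)" for z
      using that by (intro empty.prems(6)) (simp add: dist_norm norm_minus_commute)
    show "bounded (cball c r)" by (rule bounded_cball)
    show "c \<in> cball c r" using empty.prems(1) by simp
  qed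
  then show ?case by simp
next
  case (insert w W)
  define h where "h z = (if z = w then deriv f w else f z / (z - w))" for z
  \<comment> \<open>The quotient of \<open>f\<close> by the Blaschke factor of \<open>w\<close> for the disc, with the removable singularity at \<open>w\<close> filled in.\<close>
  define g where "g z = h z * (of_real (r\<^sup>2) - cnj (w - c) * (z - c)) / of_real r" for z
  have r: "0 < r" by fact
  have fw: "f w = 0" using insert.prems by simp
  have wc: "w \<noteq> c" and wr: "norm (w - c) < r"
    using insert.prems by (auto simp: dist_norm norm_minus_commute)
  have "h holomorphic_on ball c R"
    by (rule pole_theorem_open_0[OF insert.prems(3) open_ball, of w]) (auto simp: h_def fw)
  then have hol: "g holomorphic_on ball c R"
    unfolding g_def using r by (intro holomorphic_intros) auto
  have sphere: "norm (g z) \<le> M" if z: "norm (z - c) = r" for z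
  proof -
    have zw: "z \<noteq> w" using z wr by auto
    have "of_real (r\<^sup>2) = cnj (z - c) * (z - c)" unfolding cnj_mult_self z ..
    then have "of_real (r\<^sup>2) - cnj (w - c) * (z - c) = cnj (z - w) * (z - c)"
      by (simp add: algebra_simps)
    then have eq: "norm (of_real (r\<^sup>2) - cnj (w - c) * (z - c)) = norm (z - w) * r"
      by (simp only: norm_mult complex_mod_cnj z)
    have "norm (g z) = norm (f z) / norm (z - w) * (norm (z - w) * r) / r"
      unfolding g_def norm_divide norm_mult eq using zw r by (simp add: h_def norm_divide)
    also have "\<dots> = norm (f z)" using zw r by simp
    finally show ?thesis using insert.prems(6)[OF z] by simp
  qed
  have centre: "norm (g c) = norm (f c) * (r / norm (w - c))"
    using r wc by (simp add: g_def h_def norm_divide norm_mult norm_minus_commute power2_eq_square)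
  have "norm (g c) * (\<Prod>w\<in>W. r / norm (w - c)) \<le> M"
  proof (rule insert.IH[OF _ _ hol])
    show "g v = 0" if "v \<in> W" for v
    proof -
      have "v \<noteq> w" using that insert.hyps by auto
      then show ?thesis using insert.prems(5)[of v] that by (simp add: g_def h_def)
    qed
    show "W \<subseteq> ball c r - {c}" using insert.prems by auto
  qed (use insert.prems sphere in auto)
  then show ?case using insert.hyps by (simp add: centre mult.assoc)
qed

lemma norm_le_max_modulus:
  assumes f: "f analytic_on ball 0 1" and r: "0 < r" "r < 1" and z: "norm z = r"
  shows "norm (f z) \<le> max_modulus r f"
proof -
  have sub: "sphere 0 r \<subseteq> ball (0::complex) 1" using r by auto
  have "continuous_on (sphere 0 r) f"
    by (rule continuous_on_subset[OF holomorphic_on_imp_continuous_on[OF analytic_imp_holomorphic[OF f]] sub])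
  then have "compact ((\<lambda>z. norm (f z)) ` sphere 0 r)"
    by (intro compact_continuous_image continuous_on_norm) auto
  moreover have "sphere 0 r = {z :: complex. norm z = r}" by auto
  ultimately have "bdd_above ((\<lambda>z. norm (f z)) ` {z. norm z = r})"
    using bounded_imp_bdd_above[OF compact_imp_bounded] by simp
  then show ?thesis
    unfolding max_modulus_def using z by (intro cSUP_upper) auto
qed

lemma norm_le_max_modulus':
  assumes f: "f analytic_on ball 0 1" and r: "0 < r" "r < 1" and z: "norm z \<le> r"
  shows "norm (f z) \<le> max_modulus r f"
proof (rule maximum_modulus_frontier[where S = "cball 0 r" and f = f and \<xi> = z])
  have hol: "f holomorphic_on ball 0 1" using f by (rule analytic_imp_holomorphic)
  show "f holomorphic_on interior (cball 0 r)"
    using r by (intro holomorphic_on_subset[OF hol]) auto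
  have "continuous_on (cball 0 r) f"
    using r by (intro continuous_on_subset[OF holomorphic_on_imp_continuous_on[OF hol]]) auto
  then show "continuous_on (closure (cball 0 r)) f" by simp
  show "norm (f w) \<le> max_modulus r f" if "w \<in> frontier (cball 0 r)" for w
    using that r by (intro norm_le_max_modulus[OF f]) auto
qed (use z in auto)

context doubling_growth
begin

lemma interpolate_indicator:
  assumes z: "\<And>n. norm (z n) < 1" and ip: "interpolation_property z \<psi>"
  obtains f C where "f holomorphic_on ball 0 1" "C > 0" "\<And>n. f (z n) = (if n \<in> A then 1 else 0)"
    "\<And>r \<zeta>. 0 < r \<Longrightarrow> r < 1 \<Longrightarrow> norm \<zeta> \<le> r \<Longrightarrow> norm (f \<zeta>) \<le> exp (C * \<psi> (1 / (1 - r)))"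
proof -
  define b :: "nat \<Rightarrow> complex" where "b n = (if n \<in> A then 1 else 0)" for n
  have "\<forall>n. eln (norm (b n)) \<le> ereal (1 * psi_at (z n))"
    using psi_at_pos[OF z] by (auto simp: b_def eln_def less_imp_le)
  then have "\<exists>C>0. \<forall>n. eln (norm (b n)) \<le> ereal (C * psi_at (z n))"
    by (intro exI[of _ 1]) simp
  then obtain f C where f: "f analytic_on ball 0 1" and C: "C > 0" and fb: "\<forall>n. f (z n) = b n"
      and M: "\<forall>r\<in>{0<..<1}. eln (max_modulus r f) \<le> ereal (C * \<psi> (1 / (1 - r)))"
    using ip unfolding interpolation_property_def by metis
  show thesis
  proof
    show "f holomorphic_on ball 0 1" using f by (rule analytic_imp_holomorphic)
    show "C > 0" by fact
    show "f (z n) = (if n \<in> A then 1 else 0)" for n using fb by (simp add: b_def)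
    show "norm (f \<zeta>) \<le> exp (C * \<psi> (1 / (1 - r)))" if r: "0 < r" "r < 1" "norm \<zeta> \<le> r" for r \<zeta>
    proof -
      have le: "norm (f \<zeta>) \<le> max_modulus r f" by (rule norm_le_max_modulus'[OF f r])
      then have "0 \<le> max_modulus r f" using norm_ge_zero order_trans by blast
      moreover have "eln (max_modulus r f) \<le> ereal (C * \<psi> (1 / (1 - r)))" using M r(1,2) by simp
      ultimately have "max_modulus r f \<le> exp (C * \<psi> (1 / (1 - r)))" by (simp only: eln_le_iff)
      then show ?thesis using le by linarith
    qed
  qed
qed

text \<open>
  The function with value 1 at one point and 0 at the others is not identically zero, and its zeros
  cannot accumulate inside the disc.
\<close>

lemma interpolation_imp_discrete:
  assumes inj: "inj z" and z: "\<And>n. norm (z n) < 1" and ip: "interpolation_property z \<psi>"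
    and \<rho>: "\<rho> < 1"
  shows "finite {n. norm (z n) \<le> \<rho>}"
proof -
  obtain f C where hol: "f holomorphic_on ball 0 1" and fz: "\<And>n. f (z n) = (if n \<in> {0} then 1 else 0)"
    using interpolate_indicator[OF z ip, where A = "{0}"] by metis
  have "\<not> f constant_on ball 0 1"
  proof
    assume "f constant_on ball 0 1"
    then obtain c where "\<And>x. x \<in> ball 0 1 \<Longrightarrow> f x = c" unfolding constant_on_def by blast
    then have "f (z 0) = f (z 1)" using z by simp
    then show False using fz[of 0] fz[of 1] by simp
  qed
  then have fin: "finite {\<zeta>\<in>cball 0 \<rho>. f \<zeta> = 0}"
    using \<rho> by (intro holomorphic_compact_finite_zeros[OF hol]) auto
  have "z ` ({n. norm (z n) \<le> \<rho>} - {0}) \<subseteq> {\<zeta>\<in>cball 0 \<rho>. f \<zeta> = 0}" using fz by auto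
  then have "finite (z ` ({n. norm (z n) \<le> \<rho>} - {0}))" using fin finite_subset by blast
  then have "finite ({n. norm (z n) \<le> \<rho>} - {0})"
    by (rule finite_imageD) (rule inj_on_subset[OF inj], simp)
  then show ?thesis by simp
qed

text \<open>
  Since the sequence is discrete, every sum \<open>v n\<close> is finite, and only finitely many indices belong
  to points of a compact subset of the disc. If the sums \<open>v n\<close> were not \<open>O(psi_at (z n))\<close>, the exceptional
  points could therefore be chosen closer and closer to the circle, each at less than half the distance of its
  predecessor. Their discs then contain no other chosen point, and Jensen's inequality
  for the function with value 1 at the chosen points and 0 at all others bounds \<open>v\<close> along the chosen
  points by a fixed multiple of \<open>\<psi>\<close>.
\<close>

lemma interpolation_necessary:
  assumes inj: "inj z" and z: "\<And>n. norm (z n) < 1" and ip: "interpolation_property z \<psi>"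
  shows "count_sums_bounded z \<psi>"
proof -
  define r where "r n = (1 - norm (z n)) / 2" for n
  have r0: "0 < r n" for n using z[of n] by (simp add: r_def)
  define W where "W n = {j. j \<noteq> n \<and> norm (z n - z j) \<le> r n}" for n
  define v where "v n = (\<Sum>j\<in>W n. ln (r n / norm (z n - z j)))" for n
  have finW: "finite (W n)" for n
  proof (rule finite_subset)
    show "W n \<subseteq> {j. norm (z j) \<le> (1 + norm (z n)) / 2}"
    proof
      fix j assume "j \<in> W n"
      then have "norm (z j) \<le> norm (z n) + r n"
        using norm_triangle_ineq3[of "z n" "z j"] by (auto simp: W_def)
      then show "j \<in> {j. norm (z j) \<le> (1 + norm (z n)) / 2}" by (simp add: r_def field_simps)
    qed
    show "finite {j. norm (z j) \<le> (1 + norm (z n)) / 2}"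
      using z[of n] by (intro interpolation_imp_discrete[OF inj z ip]) simp
  qed
  have pos: "0 < norm (z n - z j)" if "j \<in> W n" for n j using that inj by (auto simp: W_def inj_eq)
  have ln0: "0 \<le> ln (r n / norm (z n - z j))" if "j \<in> W n" for n j
    using that pos[OF that] by (intro ln_ge_zero) (simp add: W_def)
  have "\<exists>C>0. \<forall>n. v n \<le> C * psi_at (z n)"
  proof (rule ccontr)
    assume "\<not> ?thesis"
    then have unbounded: "\<exists>n. v n > C * psi_at (z n)" if "C > 0" for C
      using that not_le by blast
    have near_boundary: "\<exists>n. 1 - norm (z n) < \<epsilon> \<and> v n > C * psi_at (z n)" if C: "C > 0" and \<epsilon>: "\<epsilon> > 0" for C \<epsilon>
    proof -
      define J where "J = {n. norm (z n) \<le> 1 - \<epsilon>}"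
      have J: "finite J" unfolding J_def by (rule interpolation_imp_discrete[OF inj z ip]) (use \<epsilon> in simp)
      have q0: "0 \<le> v n / psi_at (z n)" for n
        using psi_at_pos[OF z, of n] ln0 by (simp add: v_def sum_nonneg)
      \<comment> \<open>Large enough that \<open>v n \<le> C' * psi_at (z n)\<close> for all \<open>n\<close> in the finite set \<open>J\<close>.\<close>
      define C' where "C' = C + (\<Sum>n\<in>J. v n / psi_at (z n))"
      have C': "C \<le> C'" unfolding C'_def using q0 by (simp add: sum_nonneg)
      then obtain n where n: "v n > C' * psi_at (z n)" using unbounded[of C'] C by auto
      have "n \<notin> J"
      proof
        assume "n \<in> J"
        then have "v n / psi_at (z n) \<le> (\<Sum>n\<in>J. v n / psi_at (z n))"
          using J q0 by (intro member_le_sum) auto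
        then have "v n / psi_at (z n) \<le> C'" using C by (simp add: C'_def)
        then show False using n psi_at_pos[OF z, of n] by (simp add: pos_divide_le_eq)
      qed
      moreover have "C * psi_at (z n) \<le> C' * psi_at (z n)"
        using C' psi_at_pos[OF z, of n] by (intro mult_right_mono) auto
      ultimately show ?thesis using n by (intro exI[of _ n]) (auto simp: J_def)
    qed
    have "\<exists>m. \<forall>i. v (m i) > real (Suc i) * psi_at (z (m i)) \<and>
        1 - norm (z (m (Suc i))) < (1 - norm (z (m i))) / 2"
    proof (rule dependent_nat_choice)
      show "\<exists>n. v n > real (Suc 0) * psi_at (z n)" using near_boundary[of "real (Suc 0)" 1] by auto
      show "\<exists>n'. v n' > real (Suc (Suc i)) * psi_at (z n') \<and> 1 - norm (z n') < (1 - norm (z n)) / 2" for n i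
        using near_boundary[of "real (Suc (Suc i))" "(1 - norm (z n)) / 2"] z[of n] by (auto simp del: of_nat_Suc)
    qed
    then obtain m where large: "\<And>i. v (m i) > real (Suc i) * psi_at (z (m i))"
        and step: "\<And>i. 1 - norm (z (m (Suc i))) < (1 - norm (z (m i))) / 2" by blast
    have sep: "1 - norm (z (m l)) < (1 - norm (z (m i))) / 2" if "i < l" for i l
      using that
    proof (induction l)
      case (Suc l)
      show ?case
      proof (cases "i = l")
        case False
        then have "1 - norm (z (m l)) < (1 - norm (z (m i))) / 2" using Suc by simp
        moreover have "(1 - norm (z (m l))) / 2 < 1 - norm (z (m l))" using z[of "m l"] by simp
        ultimately show ?thesis using step[of l] by (meson less_trans)
      qed (use step in simp)
    qed simp
    obtain f C where hol: "f holomorphic_on ball 0 1" and C: "C > 0"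
        and fz: "\<And>n. f (z n) = (if n \<in> range m then 1 else 0)"
        and growth: "\<And>r \<zeta>. 0 < r \<Longrightarrow> r < 1 \<Longrightarrow> norm \<zeta> \<le> r \<Longrightarrow> norm (f \<zeta>) \<le> exp (C * \<psi> (1 / (1 - r)))"
      using interpolate_indicator[OF z ip, where A = "range m"] by metis
    have index_bound: "real (Suc i) < C * D" for i
    proof -
      define c where "c = z (m i)"
      define s where "s = r (m i)"
      \<comment> \<open>The Jensen estimate takes zeros in the open disc; those on its boundary contribute \<open>ln 1 = 0\<close>.\<close>
      define V where "V = {j\<in>W (m i). norm (c - z j) < s}"
      have s: "0 < s" "1 - norm c = 2 * s" using r0 by (auto simp: s_def c_def r_def)
      have zero: "f (z j) = 0" if j: "j \<in> V" for j
      proof -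
        have "j \<notin> range m"
        proof
          assume "j \<in> range m"
          then obtain l where l: "j = m l" by auto
          have "i \<noteq> l" using j l by (auto simp: V_def W_def)
          then consider "i < l" | "l < i" by linarith
          then have "s \<le> \<bar>norm c - norm (z j)\<bar>"
          proof cases
            case 1
            then show ?thesis using sep[OF 1] s z[of "m l"] by (simp add: c_def l)
          next
            case 2
            then show ?thesis using sep[OF 2] s by (simp add: c_def l)
          qed
          then show False using j norm_triangle_ineq3[of c "z j"] by (simp add: V_def)
        qed
        then show ?thesis using fz by simp
      qed
      have "norm (f c) * (\<Prod>w\<in>z ` V. s / norm (w - c)) \<le> exp (C * \<psi> (1 / (1 - (norm c + s))))"
      proof (rule norm_centre_mult_prod_zeros_le[where R = "2 * s"])
        show "finite (z ` V)" using finW by (simp add: V_def)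
        show "f holomorphic_on ball c (2 * s)"
        proof (rule holomorphic_on_subset[OF hol], rule subsetI)
          fix x assume "x \<in> ball c (2 * s)"
          then have "norm (x - c) < 2 * s" by (simp add: dist_norm norm_minus_commute)
          then show "x \<in> ball 0 1" using s norm_triangle_ineq2[of x c] by simp
        qed
        show "z ` V \<subseteq> ball c s - {c}"
          using pos[of _ "m i"] by (force simp: V_def c_def dist_norm)
        show "norm (f x) \<le> exp (C * \<psi> (1 / (1 - (norm c + s))))" if "norm (x - c) = s" for x
          using that s norm_triangle_ineq2[of x c] norm_ge_zero[of c] by (intro growth) linarith+
      qed (use s zero in auto)
      moreover have "f c = 1" using fz by (simp add: c_def)
      moreover have "(\<Prod>w\<in>z ` V. s / norm (w - c)) = (\<Prod>j\<in>V. s / norm (c - z j))"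
      proof -
        have "inj_on z V" using inj by (rule inj_on_subset) simp
        then show ?thesis
          by (simp only: prod.reindex o_def norm_minus_commute[of c])
      qed
      moreover have "exp (v (m i)) = (\<Prod>j\<in>V. s / norm (c - z j))"
      proof -
        have "v (m i) = (\<Sum>j\<in>V. ln (s / norm (c - z j)))"
          unfolding v_def s_def[symmetric] c_def[symmetric]
        proof (rule sum.mono_neutral_right[OF finW])
          show "\<forall>j\<in>W (m i) - V. ln (s / norm (c - z j)) = 0"
          proof
            fix j assume "j \<in> W (m i) - V"
            then have "norm (c - z j) = s" by (auto simp: V_def W_def c_def s_def)
            then show "ln (s / norm (c - z j)) = 0" using s by simp
          qed
        qed (auto simp: V_def)
        then have "exp (v (m i)) = (\<Prod>j\<in>V. exp (ln (s / norm (c - z j))))"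
          using finW by (simp add: exp_sum V_def)
        also have "\<dots> = (\<Prod>j\<in>V. s / norm (c - z j))"
          using pos[of _ "m i"] s by (intro prod.cong refl exp_ln) (auto simp: V_def c_def)
        finally show ?thesis .
      qed
      ultimately have "exp (v (m i)) \<le> exp (C * \<psi> (1 / (1 - (norm c + s))))"
        by (simp only: norm_one mult_1_left)
      then have "v (m i) \<le> C * \<psi> (1 / (1 - (norm c + s)))" by (simp only: exp_le_cancel_iff)
      also have "1 / (1 - (norm c + s)) = 2 * (1 / (1 - norm c))"
      proof -
        have "1 - (norm c + s) = s" using s by linarith
        then show ?thesis using s by simp
      qed
      also have "C * \<psi> (2 * (1 / (1 - norm c))) \<le> C * (D * psi_at c)"
        using C z[of "m i"] by (intro mult_left_mono psi_doubling) (auto simp: c_def divide_simps)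
      finally have "real (Suc i) * psi_at c < (C * D) * psi_at c"
        using large[of i] by (simp add: c_def mult.assoc)
      then show ?thesis using psi_at_pos[OF z, of "m i"] by (simp only: c_def mult_less_cancel_right_pos)
    qed
    obtain i where "C * D < real i" using reals_Archimedean2 by blast
    then show False using index_bound[of i] by simp
  qed
  then obtain C where C: "C > 0" "\<And>n. v n \<le> C * psi_at (z n)" by blast
  have "(\<Sum>j\<in>F. ln (r n / norm (z n - z j))) \<le> C * psi_at (z n)" if "F \<subseteq> W n" for n F
  proof -
    have "(\<Sum>j\<in>F. ln (r n / norm (z n - z j))) \<le> v n"
      unfolding v_def using that ln0 by (intro sum_mono2 finW) auto
    then show ?thesis using C(2)[of n] by linarith
  qed
  then have bound: "(\<Sum>j\<in>F. ln ((1 - norm (z n)) / 2 / norm (z n - z j))) \<le> C * psi_at (z n)"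
    if "F \<subseteq> {j. j \<noteq> n \<and> norm (z n - z j) \<le> (1 - norm (z n)) / 2}" for n F
    using that unfolding W_def r_def .
  show ?thesis
    unfolding count_sums_bounded_def
  proof (intro exI[of _ C] conjI allI impI)
    show "C > 0" by (rule C(1))
  qed (rule bound)
qed

end

section \<open>The equivalence\<close>

context doubling_growth
begin

lemma near_log_sum_le:
  assumes "separation_sums_bounded z \<psi>"
  shows "\<exists>L. \<forall>n F. finite F \<longrightarrow> n \<notin> F \<longrightarrow> (\<Sum>j\<in>F. near_log (z n) (z j)) \<le> L * psi_at (z n)"
proof -
  obtain C where sums: "\<And>n F. finite F \<Longrightarrow>
      F \<subseteq> {j. j \<noteq> n \<and> norm (z n - z j) < (1 - norm (z n)) / 2} \<Longrightarrow>
      (\<Sum>j\<in>F. ln (1 / pseudohyperbolic_dist (z n) (z j))) \<le> C * psi_at (z n)"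
    using assms unfolding separation_sums_bounded_def by blast
  have "(\<Sum>j\<in>F. near_log (z n) (z j)) \<le> C * psi_at (z n)" if F: "finite F" "n \<notin> F" for n F
  proof -
    define F' where "F' = {j\<in>F. norm (z n - z j) < (1 - norm (z n)) / 2}"
    have "(\<Sum>j\<in>F. near_log (z n) (z j)) = (\<Sum>j\<in>F'. near_log (z n) (z j))"
      by (rule sum.mono_neutral_right) (use F in \<open>auto simp: F'_def near_log_def\<close>)
    also have "\<dots> = (\<Sum>j\<in>F'. ln (1 / pseudohyperbolic_dist (z n) (z j)))"
      by (rule sum.cong) (auto simp: F'_def near_log_def)
    also have "\<dots> \<le> C * psi_at (z n)"
      by (rule sums) (use F in \<open>auto simp: F'_def\<close>)
    finally show ?thesis .
  qed
  then show ?thesis by blast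
qed

lemma interpolation_if_separation_sums:
  assumes inj: "inj z" and z: "\<And>n. norm (z n) < 1" and sep: "separation_sums_bounded z \<psi>"
  shows "interpolation_property z \<psi>"
proof -
  obtain B where B: "\<And>n F. finite F \<Longrightarrow> F \<subseteq> {j. norm (z n - z j) < (1 - norm (z n)) / 2} \<Longrightarrow>
      real (card F) \<le> B * psi_at (z n)"
    using card_near_le_if_separation_sums[OF inj z sep] by blast
  obtain L where L: "\<And>n F. finite F \<Longrightarrow> n \<notin> F \<Longrightarrow>
      (\<Sum>j\<in>F. near_log (z n) (z j)) \<le> L * psi_at (z n)"
    using near_log_sum_le[OF sep] by blast
  show ?thesis by (rule interpolation_sufficient) (fact inj z B L)+
qed

end

theorem theorem5:
  fixes z :: "nat \<Rightarrow> complex" and \<psi> :: "real \<Rightarrow> real"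
  assumes "inj z"
    and "\<And>n. norm (z n) < 1"
    and "\<psi> \<in> class_R"
    and "(\<lambda>x. \<psi> (2 * x)) \<in> O[at_top](\<psi>)"
  shows "(interpolation_property z \<psi> \<longleftrightarrow> integrated_count_bounded z \<psi>) \<and>
         (integrated_count_bounded z \<psi> \<longleftrightarrow> log_separation_bounded z \<psi>)"
proof -
  obtain D K where "doubling_growth \<psi> D K"
    using class_R_doubling_growth[OF assms(3,4)] by blast
  then interpret doubling_growth \<psi> D K .
  have ii: "integrated_count_bounded z \<psi> \<longleftrightarrow> count_sums_bounded z \<psi>"
    by (rule integrated_count_bounded_iff_sums[OF assms(1,2)])
  have iii: "log_separation_bounded z \<psi> \<longleftrightarrow> separation_sums_bounded z \<psi>"
    by (rule log_separation_bounded_iff_sums[OF assms(1,2)])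
  have "count_sums_bounded z \<psi> \<longleftrightarrow> separation_sums_bounded z \<psi>"
    using separation_sums_if_count_sums[OF assms(1,2)] count_sums_if_separation_sums[OF assms(1,2)]
    by blast
  moreover have "interpolation_property z \<psi> \<longrightarrow> count_sums_bounded z \<psi>"
    using interpolation_necessary[OF assms(1,2)] by blast
  moreover have "separation_sums_bounded z \<psi> \<longrightarrow> interpolation_property z \<psi>"
    using interpolation_if_separation_sums[OF assms(1,2)] by blast
  ultimately show ?thesis unfolding ii iii by blast
qed

end
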